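(* Let $z\ge y\ge2$, let $\mathcal{A}\subset\mathbb{N}$ be a primitive set, and let $f$ be a multiplicative function such that $0\le f(n)\le\tau_k(n)$ for all $n\in\mathbb{N}$, for some fixed integer $k\ge1$. If we let $L=\sum_{p\le y} \frac{f(p)}{p}$ (sum over primes), then we have the uniform estimate \[ \sum_{a\in\mathcal{A}\cap[z/y,z] } \frac{f(a)}{a} \ll_k \frac{\log y}{\sqrt{L+1}} \cdot \exp\bigg(\sum_{p\le z}\frac{f(p)-1}{p}\bigg), \] where the implied constant depends only on $k$.
   Context: A set $\mathcal{A}\subset\mathbb{N}$ is primitive if $a\nmid b$ for all distinct $a,b\in\mathcal{A}$. $\tau_k$ denotes the $k$-th divisor function, i.e. $\tau_k(n)$ is the number of ordered $k$-tuples of positive integers with product $n$. Sums over $p$ run over primes. *)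

theory Defs
  imports Complex_Main "HOL-Computational_Algebra.Primes"
begin

definition primitive_set :: "nat set \<Rightarrow> bool" where
  "primitive_set A \<longleftrightarrow> (\<forall>a\<in>A. \<forall>b\<in>A. a \<noteq> b \<longrightarrow> \<not> a dvd b)"

definition divisor_k :: "nat \<Rightarrow> nat \<Rightarrow> nat" where
  "divisor_k k n = card {xs :: nat list. length xs = k \<and> prod_list xs = n}"

definition multiplicative :: "(nat \<Rightarrow> real) \<Rightarrow> bool" where
  "multiplicative f \<longleftrightarrow> f 1 = 1 \<and>
     (\<forall>m n. m > 0 \<longrightarrow> n > 0 \<longrightarrow> coprime m n \<longrightarrow> f (m * n) = f m * f n)"

end

theory Submission
  imports Defs
begin

text \<open>
  Write each \<open>a\<close> in the set as \<open>a = x b\<close>, where \<open>x\<close> is the product of the primes \<open>p \<le> y\<close> that divide \<open>a\<close>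
  exactly once. For fixed \<open>b\<close> the prime sets of the possible \<open>x\<close> form an antichain, so a weighted LYM
  inequality bounds the sum of \<open>f(x) x\<^sup>d / x\<close> by \<open>max W\<^sup>n / n!\<close>, which is \<open>\<lless> e\<^sup>W / \<surd>(W + 1)\<close>; here
  \<open>d = ln 2 / ln y\<close> and \<open>W = L + O(1)\<close>. The \<open>b\<close> sum to \<open>O(exp (\<Sum> f(p) / p))\<close> over \<open>y < p \<le> z\<close>.

  The factor \<open>ln y / ln z\<close> is gained by multiplying the sum by \<open>ln z \<le> ln y + ln x + ln b\<close>. The term \<open>ln x\<close>
  is absorbed by \<open>x\<^sup>d / d\<close>. For \<open>ln b\<close>, the condition \<open>a \<ge> z / y\<close> gives \<open>1 \<le> 2 (b / z)\<^sup>d x\<^sup>d\<close>; one then expands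
  \<open>ln b\<close> over the prime powers \<open>q\<close> exactly dividing \<open>b\<close> and sums over \<open>q\<close> first, which by Chebyshev's
  bound costs only \<open>O(1 / d) = O(ln y)\<close>.
\<close>

section \<open>Weighted antichains\<close>

text \<open>Concavity of the logarithm around 1: the two sides agree at 0, and the derivative of
  their difference is \<open>- ln (1 - x^2)\<close>, which is nonnegative.\<close>

lemma xlnx_diff_le:
  fixes t :: real
  assumes "0 \<le> t" "t < 1"
  shows "(1 + t) * ln (1 + t) - (1 - t) * ln (1 - t) \<le> 2 * t"
proof -
  define g where "g = (\<lambda>t::real. 2 * t - ((1 + t) * ln (1 + t) - (1 - t) * ln (1 - t)))"
  have "g 0 \<le> g t"
  proof (rule DERIV_nonneg_imp_nondecreasing[OF assms(1)])
    fix x assume x: "0 \<le> x" "x \<le> t"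
    with assms have x1: "x < 1" by simp
    have "(g has_real_derivative - (ln (1 + x) + ln (1 - x))) (at x)"
      unfolding g_def using x x1
      by (auto intro!: derivative_eq_intros simp: divide_simps)
    moreover have "ln (1 + x) + ln (1 - x) \<le> 0"
    proof -
      have "ln (1 + x) + ln (1 - x) = ln ((1 + x) * (1 - x))"
        using x x1 by (simp add: ln_mult)
      also have "\<dots> \<le> ln 1"
        using x x1 mult_pos_pos[of "1 + x" "1 - x"] by (subst ln_le_cancel_iff) (auto simp: algebra_simps)
      finally show ?thesis by simp
    qed
    ultimately show "\<exists>y. (g has_real_derivative y) (at x) \<and> 0 \<le> y"
      by (intro exI[of _ "- (ln (1 + x) + ln (1 - x))"]) auto
  qed
  thus ?thesis by (simp add: g_def)
qed

text \<open>Stirling's bound with the exponent \<open>n + 1/2\<close> in place of \<open>n\<close>, which makes the induction close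
  by concavity of the logarithm: \<open>ln n \<ge> \<integral>\<close> of \<open>ln\<close> over \<open>[n - 1/2, n + 1/2]\<close>.\<close>
lemma fact_lower_bound:
  "(n + 1/2) * ln (n + 1/2) - (n + 1/2) \<le> ln (fact n :: real)" for n :: nat
proof (induction n)
  case 0
  have "ln (1/2::real) \<le> 1/2 - 1" by (rule ln_le_minus_one) simp
  thus ?case by simp
next
  case (Suc n)
  define m where "m = real n + 1"
  \<comment> \<open>Rescaling by \<open>m\<close> turns \<open>[m - 1/2, m + 1/2]\<close> into
    \<open>[1 - t, 1 + t]\<close>; since \<open>m * (2 * t) = 1\<close>, the error is exactly the
    unit by which \<open>n + 1/2\<close> grows.\<close>
  define t where "t = 1 / (2 * m)"
  have m: "m \<ge> 1" "m > 0" by (auto simp: m_def)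
  have t: "0 \<le> t" "t < 1" using m by (auto simp: t_def divide_simps)
  have mt: "m * t = 1/2" using m by (simp add: t_def)
  have e1: "m + 1/2 = m * (1 + t)" "m - 1/2 = m * (1 - t)" using mt by (simp_all add: algebra_simps)
  have l1: "ln (m + 1/2) = ln m + ln (1 + t)" "ln (m - 1/2) = ln m + ln (1 - t)"
    unfolding e1 using m t by (simp_all add: ln_mult)
  have "(m + 1/2) * ln (m + 1/2) - (m - 1/2) * ln (m - 1/2)
      = ln m + m * ((1 + t) * ln (1 + t) - (1 - t) * ln (1 - t))"
  proof -
    have "(m + 1/2) * ln (m + 1/2) - (m - 1/2) * ln (m - 1/2)
        = ln m + ((m + 1/2) * ln (1 + t) - (m - 1/2) * ln (1 - t))"
      unfolding l1 by (simp add: algebra_simps)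
    thus ?thesis unfolding e1 by (simp add: algebra_simps)
  qed
  also have "\<dots> \<le> ln m + m * (2 * t)"
    using m xlnx_diff_le[OF t] by (intro add_left_mono mult_left_mono) auto
  also have "\<dots> = ln m + 1" using mt by simp
  finally have A: "(m + 1/2) * ln (m + 1/2) - (m - 1/2) * ln (m - 1/2) \<le> ln m + 1" .
  have B: "ln (fact (Suc n) :: real) = ln m + ln (fact n)"
    using m by (simp add: ln_mult m_def add.commute)
  have C: "real n + 1/2 = m - 1/2" "real (Suc n) + 1/2 = m + 1/2" by (auto simp: m_def)
  show ?case using Suc A unfolding B C by (simp add: algebra_simps)
qed

text \<open>The largest Poisson weight has order \<open>1 / sqrt x\<close> and occurs near
  \<open>n = x\<close>. The trivial bound 1 covers small \<open>x\<close>, the Stirling bound covers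
  large \<open>x\<close>; adding them through \<open>sqrt (x + 1) \<le> sqrt x + 1\<close> produces
  the factor 2.\<close>

lemma poisson_weight_le:
  fixes x :: real
  assumes "x > 0"
  shows "x ^ n / fact n \<le> 2 * exp x / sqrt (x + 1)"
proof -
  have 1: "x ^ n \<le> exp x * fact n"
  proof -
    have "x ^ n / fact n \<le> (\<Sum>k\<le>n. x ^ k / fact k)"
      using assms by (intro member_le_sum[of n "{..n}" "\<lambda>k. x ^ k / fact k"]) auto
    also have "\<dots> = (\<Sum>k<Suc n. x ^ k /\<^sub>R fact k)"
      by (simp add: lessThan_Suc_atMost divide_inverse mult.commute)
    also have "\<dots> \<le> exp x" unfolding exp_def
      using assms summable_exp_generic[of x] by (intro sum_le_suminf) auto
    finally show ?thesis by (simp add: field_simps)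
  qed
  have 2: "sqrt x * x ^ n \<le> exp x * fact n"
  proof -
    \<comment> \<open>The 1/2 in the exponent supplies the factor \<open>sqrt x\<close>. As a
      function of \<open>x\<close>, \<open>a * ln x - x\<close> peaks at \<open>x = a\<close>, and
      its value there is the quantity controlled by \<open>fact_lower_bound\<close>.\<close>
    define a where "a = real n + 1/2"
    have a: "a > 0" by (simp add: a_def)
    have "ln (x / a) \<le> x / a - 1" using assms a by (intro ln_le_minus_one) auto
    hence "a * ln (x / a) \<le> a * (x / a - 1)" using a by (intro mult_left_mono) auto
    hence "a * ln x \<le> a * ln a - a + x" using a assms by (simp add: ln_div algebra_simps)
    also have "\<dots> \<le> ln (fact n) + x" using fact_lower_bound[of n] by (simp add: a_def)
    finally have "exp (a * ln x) \<le> exp (ln (fact n) + x)" by simp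
    also have "\<dots> = exp x * fact n" by (simp add: exp_add)
    also have "exp (a * ln x) = x powr (1/2 + real n)" using assms by (simp add: powr_def a_def add.commute)
    also have "\<dots> = sqrt x * x ^ n" using assms by (simp add: powr_add powr_realpow powr_half_sqrt)
    finally show ?thesis .
  qed
  have "sqrt (x + 1) \<le> sqrt x + 1" using sqrt_add_le_add_sqrt[of x 1] assms by simp
  hence "sqrt (x + 1) * x ^ n \<le> (sqrt x + 1) * x ^ n" using assms by (intro mult_right_mono) auto
  also have "\<dots> \<le> 2 * (exp x * fact n)" using 1 2 by (simp add: algebra_simps)
  finally show ?thesis using assms by (simp add: field_simps)
qed

text \<open>Draw elements of \<open>S\<close> independently with probabilities \<open>w p / W\<close>. The summand of \<open>s\<close> is the probability
  that the first \<open>card s\<close> draws enumerate \<open>s\<close>; for an antichain these events are disjoint.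
  The induction conditions on the first draw.\<close>
lemma weighted_LYM:
  fixes w :: "'a \<Rightarrow> real" and F :: "'a set set"
  assumes "finite S" "\<And>p. p \<in> S \<Longrightarrow> 0 \<le> w p" "sum w S \<le> W" "W > 0"
  assumes "F \<subseteq> Pow S" "\<And>s t. s \<in> F \<Longrightarrow> t \<in> F \<Longrightarrow> s \<subseteq> t \<Longrightarrow> s = t"
  shows "(\<Sum>s\<in>F. fact (card s) * prod w s / W ^ card s) \<le> 1"
proof -
  \<comment> \<open>Generalized to all antichains with cardinalities bounded by \<open>n\<close>,
    since the induction replaces \<open>F\<close> by other families.\<close>
  have "(\<Sum>s\<in>F. fact (card s) * prod w s / W ^ card s) \<le> 1"
    if "F \<subseteq> Pow S" "\<And>s t. s \<in> F \<Longrightarrow> t \<in> F \<Longrightarrow> s \<subseteq> t \<Longrightarrow> s = t" "\<And>s. s \<in> F \<Longrightarrow> card s \<le> n" for F n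
    using that
  proof (induction n arbitrary: F)
    case 0
    have "F \<subseteq> {{}}"
    proof
      fix s assume "s \<in> F"
      with 0 assms(1) have "finite s" "card s = 0" by (auto intro: finite_subset)
      thus "s \<in> {{}}" by simp
    qed
    hence "F = {} \<or> F = {{}}" by blast
    thus ?case by auto
  next
    case (Suc n)
    have finF: "finite F" using Suc.prems(1) assms(1) by (meson finite_Pow_iff finite_subset)
    have fins: "finite s" if "s \<in> F" for s using that Suc.prems(1) assms(1) by (auto intro: finite_subset)
    \<comment> \<open>An antichain containing the empty set has no other member; otherwise every
      member has a first draw.\<close>
    show ?case
    proof (cases "{} \<in> F")
      case True
      hence "F = {{}}" using Suc.prems(2) by blast
      thus ?thesis by simp
    next
      case False
      \<comment> \<open>\<open>G p\<close> consists of what is left of the members of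
        \<open>F\<close> once \<open>p\<close> has been drawn first.\<close>
      define G where "G = (\<lambda>p. (\<lambda>s. s - {p}) ` {s\<in>F. p \<in> s})"
      define H where "H = (\<lambda>s. fact (card s) * prod w s / W ^ card s)"
      \<comment> \<open>Each of the \<open>card s\<close> elements is equally likely to come first
        in an enumeration of \<open>s\<close>, so every summand equals
        \<open>H s / card s\<close>.\<close>
      have step: "H s = (\<Sum>p\<in>s. w p / W * H (s - {p}))" if "s \<in> F" for s
      proof -
        have s: "finite s" "s \<noteq> {}" using fins that False by auto
        have "w p / W * H (s - {p}) = H s / card s" if "p \<in> s" for p
        proof -
          obtain m where m: "card s = Suc m" using s by (metis card_gt_0_iff gr0_implies_Suc)
          have "prod w s = w p * prod w (s - {p})" using s that by (simp add: prod.remove)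
          moreover have "card (s - {p}) = m" using s that m by simp
          moreover have "fact (Suc m) / real (Suc m) = fact m" by simp
          ultimately show ?thesis using m unfolding H_def
            by (metis (no_types, opaque_lifting) mult.assoc mult.commute power_Suc times_divide_eq_left
                times_divide_times_eq)
        qed
        thus ?thesis using s by simp
      qed
      have "(\<Sum>s\<in>F. H s) = (\<Sum>s\<in>F. \<Sum>p\<in>s. w p / W * H (s - {p}))"
        using step by (intro sum.cong) auto
      also have "\<dots> = (\<Sum>s\<in>F. \<Sum>p | p \<in> S \<and> p \<in> s. w p / W * H (s - {p}))"
        using Suc.prems(1) by (intro sum.cong refl) auto
      also have "\<dots> = (\<Sum>p\<in>S. \<Sum>s | s \<in> F \<and> p \<in> s. w p / W * H (s - {p}))"
        using finF assms(1) by (intro sum.swap_restrict)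
      also have "\<dots> = (\<Sum>p\<in>S. w p / W * (\<Sum>s\<in>G p. H s))"
      proof (intro sum.cong refl)
        fix p
        have "inj_on (\<lambda>s. s - {p}) {s\<in>F. p \<in> s}" by (auto simp: inj_on_def)
        thus "(\<Sum>s | s \<in> F \<and> p \<in> s. w p / W * H (s - {p})) = w p / W * (\<Sum>s\<in>G p. H s)"
          unfolding G_def by (subst sum.reindex) (auto simp: sum_distrib_left)
      qed
      also have "\<dots> \<le> (\<Sum>p\<in>S. w p / W * 1)"
      proof (intro sum_mono mult_left_mono)
        fix p assume p: "p \<in> S"
        show "(\<Sum>s\<in>G p. H s) \<le> 1" unfolding H_def
        proof (rule Suc.IH)
          show "G p \<subseteq> Pow S" using Suc.prems(1) by (auto simp: G_def)
          \<comment> \<open>Both sets come from members of \<open>F\<close> containing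
            \<open>p\<close>, so putting \<open>p\<close> back preserves the inclusion.\<close>
          show "s = t" if st: "s \<in> G p" "t \<in> G p" "s \<subseteq> t" for s t
          proof -
            obtain s' t' where "s' \<in> F" "p \<in> s'" "s = s' - {p}" "t' \<in> F" "p \<in> t'" "t = t' - {p}"
              using st unfolding G_def by blast
            with Suc.prems(2)[of s' t'] st(3) show ?thesis by blast
          qed
          show "card s \<le> n" if "s \<in> G p" for s
            using that Suc.prems(3) fins by (fastforce simp: G_def)
        qed
      qed (use assms in auto)
      also have "\<dots> = sum w S / W" by (simp add: sum_divide_distrib)
      also have "\<dots> \<le> 1" using assms by simp
      finally show ?thesis by (simp add: H_def)
    qed
  qed
  moreover have "card s \<le> card S" if "s \<in> F" for s
    using that assms(1,5) by (auto intro: card_mono)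
  ultimately show ?thesis using assms(5,6) by blast
qed

text \<open>\<open>prod w s\<close> is the LYM weight of \<open>s\<close> times
  \<open>W ^ n / fact n\<close> with \<open>n = card s\<close>, and that factor is bounded uniformly
  in \<open>n\<close>. The square root saving of the final estimate originates here.\<close>

lemma antichain_weight_le:
  fixes w :: "'a \<Rightarrow> real" and F :: "'a set set"
  assumes "finite S" "\<And>p. p \<in> S \<Longrightarrow> 0 \<le> w p" "sum w S \<le> W" "W > 0"
  assumes "F \<subseteq> Pow S" "\<And>s t. s \<in> F \<Longrightarrow> t \<in> F \<Longrightarrow> s \<subseteq> t \<Longrightarrow> s = t"
  shows "(\<Sum>s\<in>F. prod w s) \<le> 2 * exp W / sqrt (W + 1)"
proof -
  let ?D = "2 * exp W / sqrt (W + 1)"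
  have "(\<Sum>s\<in>F. prod w s) \<le> (\<Sum>s\<in>F. ?D * (fact (card s) * prod w s / W ^ card s))"
  proof (intro sum_mono)
    fix s assume "s \<in> F"
    hence "0 \<le> prod w s" using assms by (intro prod_nonneg) auto
    hence "prod w s * (W ^ card s / fact (card s)) \<le> prod w s * ?D"
      using poisson_weight_le[OF assms(4)] by (intro mult_left_mono) auto
    thus "prod w s \<le> ?D * (fact (card s) * prod w s / W ^ card s)"
      using assms(4) by (simp add: field_simps)
  qed
  also have "\<dots> = ?D * (\<Sum>s\<in>F. fact (card s) * prod w s / W ^ card s)"
    by (simp add: sum_distrib_left)
  also have "\<dots> \<le> ?D * 1"
    using assms by (intro mult_left_mono weighted_LYM[OF assms(1-6)]) auto
  finally show ?thesis by simp
qed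

section \<open>Sums over primes\<close>

lemma prod_primes_dvd:
  fixes N :: nat
  assumes "finite P" "\<And>p. p \<in> P \<Longrightarrow> prime p \<and> p dvd N"
  shows "\<Prod>P dvd N"
  using assms
proof (induction P rule: finite_induct)
  case (insert q P)
  have "coprime q p" if "p \<in> P" for p
    using insert that by (intro primes_coprime) auto
  hence "coprime q (\<Prod>P)" by (intro prod_coprime_right)
  with insert show ?case by (simp add: divides_mult)
qed auto

text \<open>Induction of Erdos: for \<open>n = 2 * m + 1\<close> the primes in
  \<open>(m + 1, n]\<close> all divide \<open>n choose m\<close>, which is at most
  \<open>4 ^ m\<close>; the other primes are covered by the bound at \<open>m + 1\<close>.\<close>

lemma prod_primes_le_power4: "\<Prod>{p::nat. prime p \<and> p \<le> n} \<le> 4 ^ n"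
proof (induction n rule: less_induct)
  case (less n)
  define P where "P = (\<lambda>n. {p::nat. prime p \<and> p \<le> n})"
  have finP: "finite (P n)" for n by (rule finite_subset[of _ "{..n}"]) (auto simp: P_def)
  consider "n \<le> 1" | "n = 2" | "n > 2" "even n" | m where "n = 2 * m + 1" "m > 0"
  proof (cases "even n")
    case True
    thus ?thesis using that(1-3) by (cases "n = 0"; cases "n = 2") (auto elim!: evenE)
  next
    case False
    then obtain m where "n = 2 * m + 1" by (elim oddE)
    thus ?thesis using that(1,4) by (cases "m = 0") auto
  qed
  thus ?case
  proof cases
    case 1
    have "P n = {}" using 1 by (auto simp: P_def dest: prime_gt_1_nat)
    hence "\<Prod>(P n) = 1" by (simp only: prod.empty)
    thus ?thesis by (simp add: P_def)
  next
    case 2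
    have "P n = {2}" using 2 by (auto simp: P_def le_less_Suc_eq dest: prime_ge_2_nat)
    thus ?thesis using 2 by (simp add: P_def)
  next
    case 3
    have "\<not> prime n" using 3 by (metis primes_dvd_imp_eq two_is_prime_nat less_irrefl)
    hence "p \<le> n \<longleftrightarrow> p \<le> n - 1" if "prime p" for p using that 3 by (cases "p = n") auto
    hence "P n = P (n - 1)" unfolding P_def by blast
    hence "\<Prod>(P n) \<le> 4 ^ (n - 1)" using less[of "n - 1"] 3 by (simp add: P_def)
    also have "\<dots> \<le> 4 ^ n" by (intro power_increasing) auto
    finally show ?thesis by (simp add: P_def)
  next
    case (4 m)
    define B where "B = (2 * m + 1) choose m"
    have B: "B > 0" by (simp add: B_def)
    have sp: "P n = P (m + 1) \<union> (P n - P (m + 1))" using 4 by (auto simp: P_def)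
    have "\<Prod>(P n - P (m + 1)) dvd B"
    proof (rule prod_primes_dvd)
      fix p assume p: "p \<in> P n - P (m + 1)"
      hence pp: "prime p" "p \<le> 2 * m + 1" "p > m + 1" using 4 by (auto simp: P_def)
      have "fact m * fact (2 * m + 1 - m) * B = (fact (2 * m + 1) :: nat)"
        unfolding B_def by (rule binomial_fact_lemma) simp
      moreover have "p dvd fact (2 * m + 1)" using pp prime_dvd_fact_iff[of p "2 * m + 1"] by blast
      moreover have "\<not> p dvd fact m" "\<not> p dvd fact (2 * m + 1 - m)"
        using pp prime_dvd_fact_iff[of p m] prime_dvd_fact_iff[of p "2 * m + 1 - m"] by auto
      ultimately have "p dvd B" using pp by (metis prime_dvd_mult_iff)
      thus "prime p \<and> p dvd B" using pp by simp
    qed (use finP in auto)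
    hence 1: "\<Prod>(P n - P (m + 1)) \<le> B" using B by (rule dvd_imp_le)
    \<comment> \<open>The two middle coefficients of an odd row are equal, so each is at most half
      of the row sum.\<close>
    have "2 * B = (\<Sum>i\<in>{m, m + 1}. (2 * m + 1) choose i)"
      using binomial_symmetric[of m "2 * m + 1"] by (simp add: B_def)
    also have "\<dots> \<le> (\<Sum>i\<le>2 * m + 1. (2 * m + 1) choose i)" by (intro sum_mono2) auto
    also have "\<dots> = 2 ^ (2 * m + 1)" by (rule choose_row_sum)
    also have "\<dots> = 2 * 4 ^ m" by (simp add: power_mult)
    finally have 2: "B \<le> 4 ^ m" by simp
    have "\<Prod>(P n) = \<Prod>(P (m + 1)) * \<Prod>(P n - P (m + 1))"
      by (subst sp, rule prod.union_disjoint) (use finP in auto)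
    also have "\<dots> \<le> 4 ^ (m + 1) * 4 ^ m"
      using less[of "m + 1"] 4 1 2 by (intro mult_mono) (auto simp: P_def)
    also have "\<dots> = 4 ^ n" using 4 by (simp add: power_add[symmetric] mult_2)
    finally show ?thesis by (simp add: P_def)
  qed
qed

lemma finite_primes_le [simp]: "finite {p::nat. prime p \<and> real p \<le> x}"
  by (rule finite_subset[of _ "{..nat \<lfloor>x\<rfloor>}"]) (auto simp: le_nat_floor)

lemma sum_ln_primes_le:
  assumes "x \<ge> 0"
  shows "(\<Sum>p | prime p \<and> real p \<le> x. ln (real p)) \<le> x * ln 4"
proof -
  define n where "n = nat \<lfloor>x\<rfloor>"
  have eq: "{p. prime p \<and> real p \<le> x} = {p. prime p \<and> p \<le> n}"
    using assms by (auto simp: n_def le_nat_iff le_floor_iff)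
  have fin: "finite {p. prime p \<and> p \<le> n}" by simp
  have "(\<Sum>p | prime p \<and> real p \<le> x. ln (real p)) = ln (\<Prod>p | prime p \<and> p \<le> n. real p)"
    unfolding eq by (subst ln_prod) (auto dest: prime_gt_0_nat)
  also have "(\<Prod>p | prime p \<and> p \<le> n. real p) = real (\<Prod>{p. prime p \<and> p \<le> n})" by simp
  also have "ln \<dots> \<le> ln (real (4 ^ n))"
    using prod_primes_le_power4[of n] fin
    by (subst ln_le_cancel_iff) (auto intro!: prod_pos dest: prime_gt_0_nat simp del: of_nat_prod of_nat_power)
  also have "\<dots> = n * ln 4" by (simp add: ln_realpow)
  also have "\<dots> \<le> x * ln 4" using assms by (intro mult_right_mono) (auto simp: n_def)
  finally show ?thesis .
qed

text \<open>Dyadic substitute for partial summation: by Chebyshev the primes in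
  \<open>(x / 2, x]\<close> contribute at most \<open>2 * ln 4 * x powr d\<close>, and repeated
  halving gives a geometric series of ratio \<open>2 powr (- d)\<close>, whence the loss
  \<open>1 / d\<close>.\<close>

lemma sum_ln_powr_primes_le:
  fixes d x :: real
  assumes d: "0 < d" "d \<le> 1" and "x \<ge> 0"
  shows "(\<Sum>p | prime p \<and> real p \<le> x. ln (real p) * real p powr (d - 1)) \<le> 8 / d * x powr d"
proof -
  define T where "T = (\<lambda>x. \<Sum>p | prime p \<and> real p \<le> x. ln (real p) * real p powr (d - 1))"
  have ln4: "ln (4::real) = 2 * ln 2" using ln_realpow[of 2 2] by simp
  \<comment> \<open>The constant 8 makes the recursion close: \<open>1 - 2 powr (- d)\<close> is at
    least \<open>u / 2\<close>, and \<open>8 / d * (u / 2)\<close> equals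
    \<open>2 * ln 4\<close>.\<close>
  have key: "8 / d * 2 powr (- d) + 2 * ln 4 \<le> 8 / d"
  proof -
    define u where "u = d * ln 2"
    have l2: "0 < ln (2::real)" "ln (2::real) \<le> 1" using ln_le_minus_one[of 2] by auto
    have u: "0 < u" "u \<le> 1" using d l2 mult_le_one[of d "ln 2"] by (auto simp: u_def)
    have "2 powr (-d) = inverse (exp u)" by (simp add: powr_def u_def exp_minus)
    also have "\<dots> \<le> inverse (1 + u)" using u exp_ge_add_one_self[of u] by (intro le_imp_inverse_le) auto
    also have "\<dots> \<le> 1 - u / 2" using u by (simp add: field_simps)
    finally have "8 / d * 2 powr (- d) \<le> 8 / d * (1 - u / 2)" using d by (intro mult_left_mono) auto
    also have "\<dots> = 8 / d - 2 * ln 4" using d ln4 by (simp add: u_def field_simps)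
    finally show ?thesis by simp
  qed
  \<comment> \<open>Induction on the number of halvings that bring \<open>x\<close> below 1, where
    no primes are left.\<close>
  have "T x \<le> 8 / d * x powr d" if "0 \<le> x" "x < 2 ^ j" for j x
    using that
  proof (induction j arbitrary: x)
    case 0
    hence "{p::nat. prime p \<and> real p \<le> x} = {}" by (auto dest: prime_gt_1_nat)
    hence "T x = 0" by (simp only: T_def sum.empty)
    thus ?case using d by simp
  next
    case (Suc j)
    show ?case
    proof (cases "x = 0")
      case True
      hence "{p::nat. prime p \<and> real p \<le> x} = {}" by (auto dest: prime_gt_1_nat)
      hence "T x = 0" by (simp only: T_def sum.empty)
      thus ?thesis using d by simp
    next
      case False
      with Suc have x: "x > 0" by simp
      define P where "P = (\<lambda>x. {p::nat. prime p \<and> real p \<le> x})"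
      have "T x = T (x / 2) + (\<Sum>p\<in>P x - P (x / 2). ln (real p) * real p powr (d - 1))"
        unfolding T_def P_def
        by (subst sum.subset_diff[of "{p. prime p \<and> real p \<le> x / 2}"]) (use x in auto)
      also have "(\<Sum>p\<in>P x - P (x / 2). ln (real p) * real p powr (d - 1))
          \<le> (\<Sum>p\<in>P x - P (x / 2). ln (real p) * (2 * x powr (d - 1)))"
      proof (intro sum_mono mult_left_mono)
        fix p assume "p \<in> P x - P (x / 2)"
        hence p: "prime p" "real p > x / 2" by (auto simp: P_def)
        show "ln (real p) \<ge> 0" using p prime_ge_1_nat by auto
        have "real p powr (d - 1) \<le> (x / 2) powr (d - 1)"
          using p x d by (intro powr_mono2') auto
        also have "\<dots> = x powr (d - 1) * 2 powr (1 - d)"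
          using x by (simp add: powr_divide powr_diff)
        also have "\<dots> \<le> x powr (d - 1) * 2 powr 1"
          using d by (intro mult_left_mono powr_mono) auto
        finally show "real p powr (d - 1) \<le> 2 * x powr (d - 1)" by simp
      qed
      also have "\<dots> = (\<Sum>p\<in>P x - P (x / 2). ln (real p)) * (2 * x powr (d - 1))"
        by (rule sum_distrib_right[symmetric])
      also have "\<dots> \<le> (\<Sum>p\<in>P x. ln (real p)) * (2 * x powr (d - 1))"
        by (intro mult_right_mono sum_mono2) (auto simp: P_def Suc_le_eq dest: prime_gt_0_nat)
      also have "\<dots> \<le> (x * ln 4) * (2 * x powr (d - 1))"
        unfolding P_def using x by (intro mult_right_mono sum_ln_primes_le) auto
      also have "\<dots> = 2 * ln 4 * x powr d" using x by (simp add: powr_diff)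
      also have "T (x / 2) \<le> 8 / d * (x / 2) powr d" using Suc x by (intro Suc.IH) auto
      also have "\<dots> = 8 / d * 2 powr (-d) * x powr d" using x by (simp add: powr_divide powr_minus_divide)
      finally have "T x \<le> (8 / d * 2 powr (-d) + 2 * ln 4) * x powr d" by (simp add: algebra_simps)
      also have "\<dots> \<le> 8 / d * x powr d" using key by (intro mult_right_mono) auto
      finally show ?thesis .
    qed
  qed
  moreover obtain j where "x < 2 ^ j" using real_arch_pow[of 2 x] by auto
  ultimately show ?thesis using assms by (auto simp: T_def)
qed

section \<open>Convergent sums and the upper bound in Mertens' theorem\<close>

lemma sum_powr_neg_le:
  fixes e :: real
  assumes e: "e > 0"
  shows "(\<Sum>n=1..N. real n powr (- 1 - e)) \<le> 1 + 1 / e"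
proof -
  \<comment> \<open>Telescoping form of the integral test: the subtracted term is the tail integral.
    Indexing by \<open>Suc N\<close> makes the base case an equality.\<close>
  have "(\<Sum>n=1..Suc N. real n powr (- 1 - e)) \<le> 1 + 1 / e - real (Suc N) powr (- e) / e" for N
  proof (induction N)
    case (Suc N)
    define m where "m = real N + 2"
    have m: "m \<ge> 2" by (simp add: m_def)
    \<comment> \<open>The aim is that \<open>e * m powr (- 1 - e)\<close> is at most the drop of
      \<open>t powr (- e)\<close> from \<open>t = m - 1\<close> to \<open>t = m\<close>; after
      division by \<open>m powr (- e)\<close> this is a Bernoulli-type inequality, proved through
      the exponential.\<close>
    have "1 + e / m \<le> exp (e / m)" by (rule exp_ge_add_one_self)
    also have "\<dots> \<le> exp (- e * ln (1 - 1 / m))"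
    proof -
      have "ln (1 - 1 / m) \<le> - (1 / m)" using ln_le_minus_one[of "1 - 1 / m"] m by simp
      hence "e * (1 / m) \<le> e * (- ln (1 - 1 / m))" using e by (intro mult_left_mono) auto
      thus ?thesis by simp
    qed
    also have "\<dots> = (1 - 1 / m) powr (- e)" using m by (simp add: powr_def)
    also have "1 - 1 / m = (m - 1) / m" using m by (simp add: field_simps)
    also have "\<dots> powr (- e) = (m - 1) powr (- e) / m powr (- e)" by (rule powr_divide)
    finally have "m powr (- e) * (1 + e / m) \<le> (m - 1) powr (- e)" using m by (simp add: field_simps)
    moreover have "m powr (- 1 - e) = m powr (- e) / m"
      using m powr_add[of m "-1" "-e"] by (simp add: powr_minus_divide)
    ultimately have "e * m powr (- 1 - e) \<le> (m - 1) powr (- e) - m powr (- e)"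
      by (simp add: algebra_simps)
    hence "m powr (- 1 - e) \<le> (m - 1) powr (- e) / e - m powr (- e) / e"
      using e by (simp add: field_simps)
    moreover have m': "real (Suc (Suc N)) = m" "real (Suc N) = m - 1" by (auto simp: m_def)
    moreover have "(\<Sum>n=1..Suc (Suc N). real n powr (- 1 - e))
        = (\<Sum>n=1..Suc N. real n powr (- 1 - e)) + real (Suc (Suc N)) powr (- 1 - e)"
      by (subst sum.nat_ivl_Suc') simp_all
    ultimately show ?case using Suc unfolding m' by linarith
  qed auto
  from this[of "N - 1"] show ?thesis
  proof (cases "N = 0")
    case False
    hence "Suc (N - 1) = N" by simp
    moreover have "real N powr (- e) / e \<ge> 0" using e by simp
    ultimately show ?thesis using \<open>(\<Sum>n=1..Suc (N - 1). real n powr (- 1 - e)) \<le> _\<close> by simp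
  qed (use e in simp)
qed

text \<open>The exponent 3/2 leaves room for a factor \<open>sqrt p\<close>, so this one convergent
  sum serves all error terms of order \<open>1 / p^2\<close>, also those carrying
  \<open>ln p\<close>.\<close>

lemma sum_primes_powr_le:
  "(\<Sum>p | prime p \<and> real p \<le> x. real p powr (- 1 - 1 / 2)) \<le> 3"
proof -
  have "(\<Sum>p | prime p \<and> real p \<le> x. real p powr (- 1 - 1 / 2)) \<le> (\<Sum>n=1..nat \<lfloor>x\<rfloor>. real n powr (- 1 - 1 / 2))"
    by (intro sum_mono2) (auto simp: Suc_le_eq le_nat_floor dest: prime_gt_0_nat)
  also have "\<dots> \<le> 3" using sum_powr_neg_le[of "1/2"] by simp
  finally show ?thesis .
qed

text \<open>Unique factorization, with \<open>prime_factors\<close> as left inverse. It lets a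
  product of factors \<open>x p + 1\<close> be read as a sum over distinct squarefree
  integers.\<close>

lemma inj_on_prod_primes:
  fixes P :: "nat set"
  assumes "finite P" "\<And>p. p \<in> P \<Longrightarrow> prime p"
  shows "inj_on (\<lambda>S. \<Prod>S) (Pow P)"
proof (rule inj_on_inverseI[of _ prime_factors])
  fix S assume "S \<in> Pow P"
  hence S: "finite S" "\<And>p. p \<in> S \<Longrightarrow> prime p" using assms by (auto intro: finite_subset)
  have "prime_factors (\<Prod>S) = (\<Union>p\<in>S. prime_factors p)"
    using S by (subst prime_factors_prod) (auto dest: prime_gt_0_nat)
  also have "\<dots> = (\<Union>p\<in>S. {p})" using S by (intro SUP_cong refl) (simp add: prime_prime_factors)
  finally show "prime_factors (\<Prod>S) = S" by simp
qed

text \<open>The coefficient \<open>1\<close> of \<open>ln (ln z)\<close> comes from comparing with the Euler product of zeta at \<open>1 + 1 / ln z\<close>,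
  so that only Chebyshev's upper bound is needed.\<close>
lemma sum_inverse_primes_le:
  fixes z :: real
  assumes "z \<ge> 2"
  shows "(\<Sum>p | prime p \<and> real p \<le> z. 1 / real p) \<le> ln (ln z) + (17 / ln 2 + 3)"
proof -
  define P where "P = {p::nat. prime p \<and> real p \<le> z}"
  have finP: "finite P" by (simp add: P_def)
  have P: "prime p" "real p \<ge> 2" "real p \<le> z" if "p \<in> P" for p
    using that prime_ge_2_nat[of p] by (auto simp: P_def)
  \<comment> \<open>Shifting the exponent by \<open>1 / ln z\<close> costs
    \<open>e * (ln p / p)\<close> per prime, in total O(1), while the zeta bound
    \<open>1 + 1 / e\<close> becomes \<open>1 + ln z\<close>.\<close>
  define e where "e = 1 / ln z"
  have l2: "0 < ln (2::real)" by simp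
  have lz: "ln z \<ge> ln 2" "ln z > 0" using assms by auto
  have e: "e > 0" using lz by (simp add: e_def)
  define x where "x = (\<lambda>p::nat. real p powr (- 1 - e))"
  have xle: "x p \<le> 1 / real p" if "p \<in> P" for p
  proof -
    have "x p \<le> real p powr (-1)" unfolding x_def using P[OF that] e by (intro powr_mono) auto
    thus ?thesis using P[OF that] by (simp add: powr_minus_divide)
  qed
  have 1: "1 / real p \<le> ln (1 + x p) + real p powr (- 1 - 1 / 2) + e * (ln (real p) / real p)" if p: "p \<in> P" for p
  proof -
    have "1 - e * ln p \<le> exp (- e * ln p)" using exp_ge_add_one_self[of "- e * ln p"] by simp
    also have "\<dots> = p powr (- e)" using P[OF p] by (simp add: powr_def)
    finally have "1 / p * (1 - e * ln p) \<le> 1 / p * p powr (- e)" by (intro mult_left_mono) auto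
    also have "\<dots> = x p" using P[OF p] by (simp add: x_def powr_diff powr_minus_divide)
    finally have A: "1 / p \<le> x p + e * (ln p / p)" by (simp add: algebra_simps)
    have x0: "0 \<le> x p" "x p \<le> 1" using xle[OF p] P[OF p] by (auto simp: x_def intro: order_trans)
    have "x p - (x p)\<^sup>2 \<le> ln (1 + x p)" using x0 by (rule ln_one_plus_pos_lower_bound)
    moreover have "(x p)\<^sup>2 \<le> real p powr (- 1 - 1 / 2)"
    proof -
      have "(x p)\<^sup>2 = real p powr (2 * (- 1 - e))" using P[OF p]
        by (simp add: x_def powr_realpow[symmetric] powr_powr mult.commute)
      also have "\<dots> \<le> real p powr (- 1 - 1 / 2)" using P[OF p] e by (intro powr_mono) auto
      finally show ?thesis .
    qed
    ultimately show ?thesis using A by linarith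
  qed
  \<comment> \<open>Multiplied out, the product runs once over each squarefree \<open>n\<close>
    composed of primes in \<open>P\<close>, hence over a part of the zeta sum.\<close>
  have 2: "(\<Sum>p\<in>P. ln (1 + x p)) \<le> ln (ln z) + 1 / ln 2"
  proof -
    have pos: "x p > 0" if "p \<in> P" for p using P[OF that] by (simp add: x_def)
    have prodpos: "(\<Prod>p\<in>P. 1 + x p) > 0" using pos by (intro prod_pos) (auto intro: add_pos_pos)
    have eq: "(\<Sum>p\<in>P. ln (1 + x p)) = ln (\<Prod>p\<in>P. 1 + x p)"
      using finP by (intro ln_prod[symmetric]) (auto dest: pos)
    have "(\<Prod>p\<in>P. 1 + x p) = (\<Prod>p\<in>P. x p + 1)" by (simp add: add.commute)
    also have "\<dots> = (\<Sum>S\<in>Pow P. \<Prod>p\<in>S. x p)" using finP by (subst prod_add) auto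
    also have "\<dots> = (\<Sum>S\<in>Pow P. real (\<Prod>S) powr (- 1 - e))"
    proof (intro sum.cong refl)
      fix S assume "S \<in> Pow P"
      hence "S \<subseteq> P" "finite S" using finP by (auto intro: finite_subset)
      thus "(\<Prod>p\<in>S. x p) = real (\<Prod>S) powr (- 1 - e)"
        unfolding x_def by (simp add: prod_powr_distrib)
    qed
    also have "\<dots> = (\<Sum>n\<in>(\<lambda>S. \<Prod>S) ` Pow P. real n powr (- 1 - e))"
      using inj_on_prod_primes[OF finP P(1)] by (subst sum.reindex) auto
    also have "\<dots> \<le> (\<Sum>n=1..\<Prod>P. real n powr (- 1 - e))"
    proof (intro sum_mono2)
      show "(\<lambda>S. \<Prod>S) ` Pow P \<subseteq> {1..\<Prod>P}"
      proof safe
        fix S assume S: "S \<subseteq> P"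
        have "\<Prod>P > 0" using P(1) by (intro prod_pos) (auto dest: prime_gt_0_nat)
        moreover have "\<Prod>S dvd \<Prod>P" using finP S by (intro prod_dvd_prod_subset)
        moreover have "\<Prod>S > 0" using P(1) S by (intro prod_pos) (auto dest: prime_gt_0_nat)
        ultimately show "\<Prod>S \<in> {1..\<Prod>P}" using dvd_imp_le[of "\<Prod>S" "\<Prod>P"] by simp
      qed
    qed auto
    also have "\<dots> \<le> 1 + 1 / e" using e by (rule sum_powr_neg_le)
    also have "\<dots> = ln z * (1 + 1 / ln z)" using lz by (simp add: e_def field_simps)
    finally have "(\<Sum>p\<in>P. ln (1 + x p)) \<le> ln (ln z * (1 + 1 / ln z))"
      unfolding eq using prodpos by (intro ln_mono) auto
    also have "\<dots> = ln (ln z) + ln (1 + 1 / ln z)" using lz add_pos_pos[of 1 "1 / ln z"] by (intro ln_mult_pos) auto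
    also have "ln (1 + 1 / ln z) \<le> 1 / ln z" using lz by (intro ln_add_one_self_le_self) auto
    also have "1 / ln z \<le> 1 / ln 2" using lz l2 by (intro frac_le) auto
    finally show ?thesis by simp
  qed
  have 3: "(\<Sum>p\<in>P. real p powr (- 1 - 1 / 2)) \<le> 3"
    unfolding P_def by (rule sum_primes_powr_le)
  \<comment> \<open>A case of the tilted Chebyshev sum: inserting \<open>p powr d\<close> only
    enlarges the terms, and \<open>d = ln 2 / ln z\<close> makes
    \<open>z powr d = 2\<close>.\<close>
  have 4: "(\<Sum>p\<in>P. ln (real p) / real p) \<le> 16 / ln 2 * ln z"
  proof -
    define d where "d = ln 2 / ln z"
    have d: "0 < d" "d \<le> 1"
      unfolding d_def using lz l2 by (simp_all only: divide_pos_pos divide_le_eq_1_pos)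
    have "(\<Sum>p\<in>P. ln (real p) / real p) \<le> (\<Sum>p\<in>P. ln (real p) * real p powr (d - 1))"
    proof (intro sum_mono)
      fix p assume p: "p \<in> P"
      have "1 / real p = real p powr (-1)" using P[OF p] by (simp add: powr_minus_divide)
      also have "\<dots> \<le> real p powr (d - 1)" using P[OF p] d by (intro powr_mono) auto
      finally have "ln (real p) * (1 / real p) \<le> ln (real p) * real p powr (d - 1)"
        using P[OF p] by (intro mult_left_mono) auto
      thus "ln (real p) / real p \<le> ln (real p) * real p powr (d - 1)" by simp
    qed
    also have "\<dots> \<le> 8 / d * z powr d" unfolding P_def using d assms by (intro sum_ln_powr_primes_le) auto
    also have "z powr d = 2" using assms lz by (simp add: powr_def d_def)
    also have "8 / d * 2 = 16 / ln 2 * ln z" by (simp add: d_def)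
    finally show ?thesis .
  qed
  have "(\<Sum>p\<in>P. 1 / real p) \<le> (\<Sum>p\<in>P. ln (1 + x p) + real p powr (- 1 - 1 / 2) + e * (ln (real p) / real p))"
    by (intro sum_mono 1)
  also have "\<dots> = (\<Sum>p\<in>P. ln (1 + x p)) + (\<Sum>p\<in>P. real p powr (- 1 - 1 / 2)) + e * (\<Sum>p\<in>P. ln (real p) / real p)"
    by (simp add: sum.distrib sum_distrib_left)
  also have "\<dots> \<le> (ln (ln z) + 1 / ln 2) + 3 + e * (16 / ln 2 * ln z)"
    using e by (intro add_mono mult_left_mono 2 3 4) auto
  also have "e * (16 / ln 2 * ln z) = 16 / ln 2" using lz by (simp add: e_def)
  finally show ?thesis by (simp add: P_def)
qed

section \<open>Multiplicative functions\<close>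

text \<open>Every entry of such a tuple is one of the \<open>v + 1\<close> powers
  \<open>p ^ i\<close> with \<open>i \<le> v\<close>. This polynomial bound is all that is later
  used about \<open>divisor_k\<close>.\<close>

lemma divisor_k_prime_power_le:
  assumes "prime p"
  shows "divisor_k k (p ^ v) \<le> (v + 1) ^ k"
proof -
  define D where "D = (\<lambda>i. p ^ i) ` {..v}"
  have "{xs :: nat list. length xs = k \<and> prod_list xs = p ^ v} \<subseteq> {xs. set xs \<subseteq> D \<and> length xs = k}"
  proof safe
    fix xs :: "nat list" and x assume "prod_list xs = p ^ v" "x \<in> set xs"
    hence "x dvd p ^ v" using prod_list_dvd[of x xs] by simp
    thus "x \<in> D" using assms by (auto simp: divides_primepow_nat D_def)
  qed
  moreover have "finite D" by (simp add: D_def)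
  ultimately have "divisor_k k (p ^ v) \<le> card D ^ k"
    unfolding divisor_k_def
    by (subst card_lists_length_eq[symmetric]) (auto intro!: card_mono finite_lists_length_eq)
  also have "card D \<le> v + 1" unfolding D_def by (rule order_trans[OF card_image_le]) auto
  finally show ?thesis by (simp add: power_mono)
qed

text \<open>The ratio 3/2 is below 2, so that dividing by \<open>p ^ v\<close> still leaves a
  geometric decay at \<open>p = 2\<close>. Bernoulli's inequality for the \<open>K\<close>-th root
  \<open>r\<close> of 3/2 bounds \<open>v + 1\<close> by a multiple of \<open>r ^ v\<close>.\<close>

lemma power_le_geometric:
  "\<exists>M>0. \<forall>v::nat. (real v + 1) ^ K \<le> M * (3 / 2) ^ v"
proof (cases "K = 0")
  case True
  thus ?thesis by (intro exI[of _ 1]) auto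
next
  case False
  define r where "r = root K (3 / 2)"
  have r: "r > 1" "r ^ K = 3 / 2" using False by (auto simp: r_def real_root_gt_1_iff)
  have "r ^ 1 \<le> r ^ K" using False r by (intro power_increasing) auto
  hence r2: "r \<le> 2" using r by simp
  have "(real v + 1) ^ K \<le> (1 / (r - 1)) ^ K * (3 / 2) ^ v" for v
  proof -
    have "(real v + 1) * (r - 1) \<le> 1 + real v * (r - 1)" using r2 by (simp add: algebra_simps)
    also have "\<dots> \<le> r ^ v" using Bernoulli_inequality[of "r - 1" v] r by simp
    finally have "real v + 1 \<le> 1 / (r - 1) * r ^ v" using r by (simp add: field_simps)
    hence "(real v + 1) ^ K \<le> (1 / (r - 1) * r ^ v) ^ K" by (intro power_mono) auto
    also have "\<dots> = (1 / (r - 1)) ^ K * (r ^ K) ^ v" by (simp add: power_mult_distrib power_mult[symmetric] mult.commute power_divide)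
    finally show ?thesis using r by simp
  qed
  thus ?thesis using r by (intro exI[of _ "(1 / (r - 1)) ^ K"]) auto
qed

text \<open>The geometric majorant has ratio \<open>3 / (2 * p) \<le> 3 / 4\<close>, so its first
  term, of order \<open>1 / p^2\<close>, controls the sum uniformly in \<open>p\<close> and in the
  truncation \<open>N\<close>.\<close>

lemma prime_power_tail_le:
  "\<exists>C>0. \<forall>p N. p \<ge> 2 \<longrightarrow> (\<Sum>v=2..N. (real v + 1) ^ K / real p ^ v) \<le> C / (real p)\<^sup>2"
proof -
  obtain M where M: "M > 0" "\<And>v::nat. (real v + 1) ^ K \<le> M * (3 / 2) ^ v"
    using power_le_geometric by blast
  have "(\<Sum>v=2..N. (real v + 1) ^ K / real p ^ v) \<le> 9 * M / (real p)\<^sup>2" if p: "p \<ge> 2" for p N :: nat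
  proof -
    define x where "x = 3 / (2 * real p)"
    have x: "0 < x" "x \<le> 3 / 4" using p by (auto simp: x_def field_simps)
    have geo: "(\<Sum>v=2..N. x ^ v) \<le> 4 * x\<^sup>2"
    proof -
      have "(\<Sum>v=2..N. x ^ v) = (if N < 2 then 0 else (x\<^sup>2 - x ^ Suc N) / (1 - x))"
        using x by (subst sum_gp) auto
      also have "\<dots> \<le> x\<^sup>2 / (1 - x)" using x by (auto intro!: divide_right_mono)
      also have "\<dots> \<le> x\<^sup>2 / (1 / 4)" using x by (intro divide_left_mono) auto
      finally show ?thesis by simp
    qed
    have "(\<Sum>v=2..N. (real v + 1) ^ K / real p ^ v) \<le> (\<Sum>v=2..N. M * x ^ v)"
    proof (intro sum_mono)
      fix v
      have "(real v + 1) ^ K / real p ^ v \<le> M * (3 / 2) ^ v / real p ^ v"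
        using M by (intro divide_right_mono) auto
      also have "\<dots> = M * x ^ v" by (simp add: x_def power_divide power_mult_distrib)
      finally show "(real v + 1) ^ K / real p ^ v \<le> M * x ^ v" .
    qed
    also have "\<dots> = M * (\<Sum>v=2..N. x ^ v)" by (simp add: sum_distrib_left)
    also have "\<dots> \<le> M * (4 * x\<^sup>2)" using M geo by (intro mult_left_mono) auto
    also have "\<dots> = 9 * M / (real p)\<^sup>2" by (simp add: x_def power2_eq_square)
    finally show ?thesis .
  qed
  thus ?thesis using M by (intro exI[of _ "9 * M"]) auto
qed

section \<open>Finite Euler products\<close>

lemma coprime_cofactor:
  fixes n q :: nat
  assumes "prime q" "n > 0"
  obtains m where "n = q ^ multiplicity q n * m" "m > 0" "coprime (q ^ multiplicity q n) m"
    "\<And>p. prime p \<Longrightarrow> multiplicity p m = (if p = q then 0 else multiplicity p n)"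
proof -
  define v where "v = multiplicity q n"
  obtain m where m: "n = q ^ v * m" "\<not> q dvd m"
  proof (rule multiplicity_decompose'[of n q])
    show "n \<noteq> 0" "\<not> is_unit q" using assms by (auto dest: not_prime_unit)
  qed (simp add: v_def)
  have m0: "m > 0" using m assms by (cases m) auto
  have "coprime q m" using m assms by (simp add: prime_imp_coprime)
  moreover have "multiplicity p m = (if p = q then 0 else multiplicity p n)" if p: "prime p" for p
  proof (cases "p = q")
    case False
    have "multiplicity p n = multiplicity p (q ^ v) + multiplicity p m"
      unfolding m(1) using p m0 assms
      by (intro prime_elem_multiplicity_mult_distrib) (auto dest: prime_gt_0_nat)
    thus ?thesis using False p assms by (simp add: multiplicity_distinct_prime_power)
  qed (use m in \<open>simp add: not_dvd_imp_multiplicity_0\<close>)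
  ultimately show ?thesis using m m0 that unfolding v_def by simp
qed

text \<open>Peeling off the power of \<open>q\<close> sends \<open>n\<close> to a pair
  \<open>(v, m)\<close> from which it is recovered as \<open>q ^ v * m\<close>; pairs not coming
  from \<open>T\<close> only enlarge the right side.\<close>

lemma sum_multiplicative_le_prod:
  fixes h :: "nat \<Rightarrow> real"
  assumes mult: "multiplicative h" and nonneg: "\<And>n. n > 0 \<Longrightarrow> 0 \<le> h n"
  assumes "finite P" "\<And>p. p \<in> P \<Longrightarrow> prime p" "finite T"
    and "\<And>n. n \<in> T \<Longrightarrow> n > 0 \<and> prime_factors n \<subseteq> P \<and> (\<forall>p. prime p \<longrightarrow> multiplicity p n \<le> N)"
  shows "sum h T \<le> (\<Prod>p\<in>P. \<Sum>v\<le>N. h (p ^ v))"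
  using assms(3-6)
proof (induction P arbitrary: T rule: finite_induct)
  case empty
  have "T \<subseteq> {1}"
  proof
    fix n assume "n \<in> T"
    hence "n > 0" "prime_factors n = {}" using empty by auto
    thus "n \<in> {1}" using prod_prime_factors[of n] by simp
  qed
  hence "T = {} \<or> T = {1}" by blast
  thus ?case using mult by (auto simp: multiplicative_def)
next
  case (insert q P)
  have q: "prime q" using insert by auto
  define c where "c = (\<lambda>n. n div q ^ multiplicity q n)"
  have c: "n = q ^ multiplicity q n * c n" "c n > 0" "coprime (q ^ multiplicity q n) (c n)"
    "\<And>p. prime p \<Longrightarrow> multiplicity p (c n) = (if p = q then 0 else multiplicity p n)" if n0: "n > 0" for n
  proof -
    obtain m where m: "n = q ^ multiplicity q n * m" "m > 0" "coprime (q ^ multiplicity q n) m"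
      "\<And>p. prime p \<Longrightarrow> multiplicity p m = (if p = q then 0 else multiplicity p n)"
      using coprime_cofactor[OF q n0] by blast
    have "c n = m" unfolding c_def using m(1) q
      by (metis nonzero_mult_div_cancel_left not_prime_0 power_not_zero)
    thus "n = q ^ multiplicity q n * c n" "c n > 0" "coprime (q ^ multiplicity q n) (c n)"
      "\<And>p. prime p \<Longrightarrow> multiplicity p (c n) = (if p = q then 0 else multiplicity p n)"
      using m by auto
  qed
  have "sum h T \<le> (\<Sum>(v, m)\<in>{..N} \<times> c ` T. h (q ^ v) * h m)"
  proof (rule sum_le_included[where i = "\<lambda>(v, m). q ^ v * m"])
    show "\<forall>x\<in>{..N} \<times> c ` T. 0 \<le> (case x of (v, m) \<Rightarrow> h (q ^ v) * h m)"
      using c insert.prems q by (auto intro!: mult_nonneg_nonneg nonneg simp: prime_gt_0_nat)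
    show "\<forall>n\<in>T. \<exists>y\<in>{..N} \<times> c ` T. (case y of (v, m) \<Rightarrow> q ^ v * m) = n \<and>
        h n \<le> (case y of (v, m) \<Rightarrow> h (q ^ v) * h m)"
    proof
      fix n assume n: "n \<in> T"
      hence n0: "n > 0" and le: "multiplicity q n \<le> N" using insert.prems q by auto
      have "h n = h (q ^ multiplicity q n) * h (c n)"
        using c[OF n0] mult q unfolding multiplicative_def
        by (metis prime_gt_0_nat zero_less_power)
      thus "\<exists>y\<in>{..N} \<times> c ` T. (case y of (v, m) \<Rightarrow> q ^ v * m) = n \<and>
        h n \<le> (case y of (v, m) \<Rightarrow> h (q ^ v) * h m)"
        using c(1)[OF n0] n le by (intro bexI[of _ "(multiplicity q n, c n)"]) auto
    qed
  qed (use insert in auto)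
  also have "\<dots> = (\<Sum>v\<le>N. h (q ^ v)) * sum h (c ` T)"
    by (simp add: sum.cartesian_product[symmetric] sum_product)
  also have "\<dots> \<le> (\<Sum>v\<le>N. h (q ^ v)) * (\<Prod>p\<in>P. \<Sum>v\<le>N. h (p ^ v))"
  proof (intro mult_left_mono insert.IH sum_nonneg nonneg)
    fix m assume "m \<in> c ` T"
    then obtain n where n: "n \<in> T" "m = c n" by blast
    hence n0: "n > 0" using insert.prems by auto
    have "prime_factors m \<subseteq> P"
    proof
      fix p assume "p \<in> prime_factors m"
      hence p: "prime p" "multiplicity p m > 0" by (auto simp: prime_factors_multiplicity)
      hence "p \<noteq> q" "multiplicity p n > 0" using c(4)[OF n0 p(1)] n by (auto split: if_splits)
      thus "p \<in> P" using p insert.prems(3)[OF n(1)] by (auto simp: prime_factors_multiplicity)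
    qed
    thus "m > 0 \<and> prime_factors m \<subseteq> P \<and> (\<forall>p. prime p \<longrightarrow> multiplicity p m \<le> N)"
      using c(2,4)[OF n0] n insert.prems(3)[OF n(1)] by auto
  qed (use insert q in \<open>auto dest: prime_gt_0_nat\<close>)
  finally show ?case using insert by simp
qed

text \<open>The condition on the cofactors \<open>b\<close>. Multiplicity 0 is allowed and primes
  above \<open>y\<close> are free, so the Euler factors at \<open>p \<le> y\<close> are
  \<open>1 + O(1 / p^2)\<close>.\<close>

definition sqfull_below :: "real \<Rightarrow> nat \<Rightarrow> bool" where
  "sqfull_below y n \<longleftrightarrow> (\<forall>p. prime p \<longrightarrow> real p \<le> y \<longrightarrow> multiplicity p n \<noteq> 1)"

text \<open>A prime divides at most one of two coprime factors. Hence the indicator of the condition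
  is multiplicative and can be built into an Euler product.\<close>

lemma sqfull_below_mult_iff:
  assumes "coprime m n" "m > 0" "n > 0"
  shows "sqfull_below y (m * n) \<longleftrightarrow> sqfull_below y m \<and> sqfull_below y n"
proof -
  have "multiplicity p (m * n) \<noteq> 1 \<longleftrightarrow> multiplicity p m \<noteq> 1 \<and> multiplicity p n \<noteq> 1" if p: "prime p" for p
  proof -
    have "multiplicity p (m * n) = multiplicity p m + multiplicity p n"
      using assms p by (intro prime_elem_multiplicity_mult_distrib) auto
    moreover have "\<not> p dvd m \<or> \<not> p dvd n"
      using assms(1) p coprime_common_divisor[of m n p] not_prime_unit[of p] by blast
    hence "multiplicity p m = 0 \<or> multiplicity p n = 0" by (metis not_dvd_imp_multiplicity_0)
    ultimately show ?thesis by auto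
  qed
  thus ?thesis unfolding sqfull_below_def by blast
qed

lemma sqfull_below_cofactor:
  assumes "sqfull_below y b" "\<And>p. prime p \<Longrightarrow> multiplicity p m = (if p = q then 0 else multiplicity p b)"
  shows "sqfull_below y m"
  using assms unfolding sqfull_below_def by auto

lemma multiplicity_le_self:
  fixes p n :: nat
  assumes "prime p" "n > 0"
  shows "multiplicity p n \<le> n"
proof -
  have "multiplicity p n < 2 ^ multiplicity p n" by (rule less_exp)
  also have "\<dots> \<le> p ^ multiplicity p n" using assms by (intro power_mono prime_ge_2_nat) auto
  also have "\<dots> \<le> n" using assms by (intro dvd_imp_le multiplicity_dvd)
  finally show ?thesis by simp
qed

lemma finite_nats_le [simp]: "finite {b::nat. 0 < b \<and> real b \<le> z \<and> Q b}"
  by (rule finite_subset[of _ "{..nat \<lfloor>z\<rfloor>}"]) (auto simp: le_nat_floor)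

text \<open>Bound by the Euler product and apply \<open>1 + t \<le> exp t\<close> to each factor:
  only primes above \<open>y\<close> keep a term \<open>f p / p\<close>, and all higher powers
  together cost the constant \<open>exp (3 * C)\<close>.\<close>

lemma sum_sqfull_below_le:
  "\<exists>C>0. \<forall>y z f. 2 \<le> z \<longrightarrow> multiplicative f \<longrightarrow> (\<forall>n>0. 0 \<le> f n) \<longrightarrow>
     (\<forall>p v. prime p \<longrightarrow> f (p ^ v) \<le> (real v + 1) ^ k) \<longrightarrow>
     (\<Sum>b | 0 < b \<and> real b \<le> z \<and> sqfull_below y b. f b / real b)
       \<le> C * exp (\<Sum>p | prime p \<and> real p \<le> z \<and> y < real p. f p / real p)"
proof -
  obtain C where C: "C > 0"
    "\<And>p N. p \<ge> 2 \<Longrightarrow> (\<Sum>v=2..N. (real v + 1) ^ k / real p ^ v) \<le> C / (real p)\<^sup>2"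
    using prime_power_tail_le[of k] by blast
  have "(\<Sum>b | 0 < b \<and> real b \<le> z \<and> sqfull_below y b. f b / real b)
       \<le> exp (3 * C) * exp (\<Sum>p | prime p \<and> real p \<le> z \<and> y < real p. f p / real p)"
    if z: "2 \<le> z" and mf: "multiplicative f" and nn: "\<And>n. n > 0 \<Longrightarrow> 0 \<le> f n"
      and fp: "\<And>p v. prime p \<Longrightarrow> f (p ^ v) \<le> (real v + 1) ^ k" for y z :: real and f :: "nat \<Rightarrow> real"
  proof -
    define h where "h = (\<lambda>n. if sqfull_below y n then f n / real n else 0)"
    define B where "B = {b. 0 < b \<and> real b \<le> z \<and> sqfull_below y b}"
    define P where "P = {p. prime p \<and> real p \<le> z}"
    define N where "N = nat \<lfloor>z\<rfloor>"
    have P: "prime p" "real p \<ge> 2" "p > 0" if "p \<in> P" for p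
      using that prime_ge_2_nat[of p] by (auto simp: P_def)
    have mh: "multiplicative h"
      unfolding multiplicative_def
    proof (intro conjI allI impI)
      show "h 1 = 1" using mf by (simp add: h_def sqfull_below_def multiplicative_def)
    next
      fix m n :: nat assume mn: "m > 0" "n > 0" "coprime m n"
      thus "h (m * n) = h m * h n"
        using mf sqfull_below_mult_iff[OF mn(3,1,2), of y] by (auto simp: h_def multiplicative_def)
    qed
    have "(\<Sum>b\<in>B. f b / real b) = sum h B" by (intro sum.cong) (auto simp: B_def h_def)
    also have "\<dots> \<le> (\<Prod>p\<in>P. \<Sum>v\<le>N. h (p ^ v))"
    proof (rule sum_multiplicative_le_prod[OF mh])
      fix n assume n: "n \<in> B"
      have "prime_factors n \<subseteq> P"
      proof
        fix p assume "p \<in> prime_factors n"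
        hence p: "prime p" "p dvd n" by auto
        hence "p \<le> n" using n by (intro dvd_imp_le) (auto simp: B_def)
        thus "p \<in> P" using n p by (auto simp: P_def B_def)
      qed
      moreover have "n \<le> N" using n by (auto simp: B_def N_def le_nat_floor)
      hence "multiplicity p n \<le> N" if "prime p" for p
        using multiplicity_le_self[OF that, of n] n by (simp add: B_def)
      ultimately show "n > 0 \<and> prime_factors n \<subseteq> P \<and> (\<forall>p. prime p \<longrightarrow> multiplicity p n \<le> N)"
        using n by (auto simp: B_def)
    qed (auto simp: h_def B_def P_def nn)
    also have "\<dots> \<le> (\<Prod>p\<in>P. exp ((if y < real p then f p / real p else 0) + C * real p powr (- 1 - 1 / 2)))"
    proof (intro prod_mono conjI)
      fix p assume p: "p \<in> P"
      show "0 \<le> (\<Sum>v\<le>N. h (p ^ v))" using P[OF p] nn by (intro sum_nonneg) (auto simp: h_def)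
      have N: "N \<ge> 2" using z by (auto simp: N_def le_nat_iff le_floor_iff)
      have "{..N} = {0, 1} \<union> {2..N}" using N by auto
      hence "(\<Sum>v\<le>N. h (p ^ v)) = h 1 + h p + (\<Sum>v=2..N. h (p ^ v))"
        by (simp add: sum.union_disjoint)
      also have "h 1 = 1" using mh by (simp add: multiplicative_def)
      \<comment> \<open>For \<open>p \<le> y\<close> the term vanishes, because \<open>p\<close>
        divides itself exactly once.\<close>
      also have "h p \<le> (if y < real p then f p / real p else 0)"
      proof (cases "y < real p")
        case False
        hence "\<not> sqfull_below y p" using P[OF p] by (auto simp: sqfull_below_def intro!: exI[of _ p])
        thus ?thesis using False by (simp add: h_def)
      qed (use P[OF p] nn in \<open>auto simp: h_def\<close>)
      also have "(\<Sum>v=2..N. h (p ^ v)) \<le> (\<Sum>v=2..N. (real v + 1) ^ k / real p ^ v)"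
        using P[OF p] fp[of p] nn by (intro sum_mono) (auto simp: h_def intro!: divide_right_mono)
      also have "\<dots> \<le> C / (real p)\<^sup>2" using P[OF p] by (intro C) auto
      also have "\<dots> = C * real p powr (- 2)" using P[OF p] by (simp add: powr_minus_divide)
      also have "\<dots> \<le> C * real p powr (- 1 - 1 / 2)"
        using C(1) P[OF p] by (intro mult_left_mono powr_mono) auto
      finally have "(\<Sum>v\<le>N. h (p ^ v)) \<le>
          1 + ((if y < real p then f p / real p else 0) + C * real p powr (- 1 - 1 / 2))" by simp
      also have "\<dots> \<le> exp ((if y < real p then f p / real p else 0) + C * real p powr (- 1 - 1 / 2))"
        by (rule exp_ge_add_one_self)
      finally show "(\<Sum>v\<le>N. h (p ^ v)) \<le>
        exp ((if y < real p then f p / real p else 0) + C * real p powr (- 1 - 1 / 2))" .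
    qed
    also have "\<dots> = exp ((\<Sum>p\<in>P. if y < real p then f p / real p else 0) + C * (\<Sum>p\<in>P. real p powr (- 1 - 1 / 2)))"
      by (subst exp_sum[symmetric]) (auto simp: P_def sum.distrib sum_distrib_left)
    also have "(\<Sum>p\<in>P. if y < real p then f p / real p else 0) = (\<Sum>p | prime p \<and> real p \<le> z \<and> y < real p. f p / real p)"
      by (subst sum.inter_filter[symmetric]) (auto simp: P_def conj_ac intro!: sum.cong)
    also have "exp (\<dots> + C * (\<Sum>p\<in>P. real p powr (- 1 - 1 / 2))) \<le> exp (\<dots> + C * 3)"
      using C(1) sum_primes_powr_le[of z] by (simp add: P_def)
    also have "\<dots> = exp (3 * C) * exp (\<Sum>p | prime p \<and> real p \<le> z \<and> y < real p. f p / real p)"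
      by (simp add: exp_add[symmetric] add.commute mult.commute)
    finally show ?thesis by (simp add: B_def)
  qed
  thus ?thesis by (intro exI[of _ "exp (3 * C)"]) auto
qed

section \<open>Sums weighted by logarithms of prime powers\<close>

lemma finite_prime_powers_le:
  "finite {(p, v). prime p \<and> 0 < v \<and> real (p ^ v) \<le> X}"
proof -
  have "{(p, v). prime p \<and> 0 < v \<and> real (p ^ v) \<le> X} \<subseteq> {..nat \<lfloor>X\<rfloor>} \<times> {..nat \<lfloor>X\<rfloor>}"
  proof clarify
    fix p v :: nat assume pv: "prime p" "0 < v" "real (p ^ v) \<le> X"
    hence "p ^ v \<le> nat \<lfloor>X\<rfloor>" by (simp add: le_nat_floor)
    moreover have "p ^ 1 \<le> p ^ v" using pv by (intro power_increasing) (auto simp: Suc_le_eq prime_gt_0_nat)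
    moreover have "v < p ^ v"
      using less_exp[of v] power_mono[of 2 p v] prime_ge_2_nat[OF pv(1)] by linarith
    ultimately show "p \<in> {..nat \<lfloor>X\<rfloor>} \<and> v \<in> {..nat \<lfloor>X\<rfloor>}" by auto
  qed
  thus ?thesis by (rule finite_subset) auto
qed

lemma ln_div_square_le:
  assumes "x \<ge> (1::real)"
  shows "ln x / x\<^sup>2 \<le> 2 * x powr (- 1 - 1 / 2)"
proof -
  have "ln x = 2 * ln (x powr (1 / 2))" using assms by (simp add: ln_powr)
  also have "\<dots> \<le> 2 * x powr (1 / 2)"
    using assms ln_le_minus_one[of "x powr (1 / 2)"] by simp
  finally have "ln x / x\<^sup>2 \<le> 2 * x powr (1 / 2) / x\<^sup>2" by (intro divide_right_mono) auto
  also have "\<dots> = 2 * (x powr (1 / 2) / x powr 2)" using assms by simp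
  also have "x powr (1 / 2) / x powr 2 = x powr (- 1 - 1 / 2)" by (subst powr_diff[symmetric]) simp
  finally show ?thesis .
qed

text \<open>The loss \<open>1 / d\<close> comes from the first powers, through the tilted Chebyshev
  sum. For higher powers the factor \<open>powr d\<close> is at most 1 and the rest converges
  absolutely.\<close>

lemma sum_prime_powers_le:
  "\<exists>C>0. \<forall>d X f. 0 < d \<longrightarrow> d \<le> 1 \<longrightarrow> 0 < X \<longrightarrow> (\<forall>n>0. 0 \<le> f n) \<longrightarrow>
     (\<forall>p v. prime p \<longrightarrow> f (p ^ v) \<le> (real v + 1) ^ k) \<longrightarrow>
     (\<Sum>(p, v) | prime p \<and> 0 < v \<and> real (p ^ v) \<le> X.
         f (p ^ v) / real (p ^ v) * ln (real (p ^ v)) * (real (p ^ v) / X) powr d) \<le> C / d"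
proof -
  \<comment> \<open>The exponent is \<open>k + 1\<close> because
    \<open>ln (p ^ v) = v * ln p\<close> brings one more factor \<open>v\<close>.\<close>
  obtain C where C: "C > 0"
    "\<And>p N. p \<ge> 2 \<Longrightarrow> (\<Sum>v=2..N. (real v + 1) ^ (k + 1) / real p ^ v) \<le> C / (real p)\<^sup>2"
    using prime_power_tail_le[of "k + 1"] by blast
  have "(\<Sum>(p, v) | prime p \<and> 0 < v \<and> real (p ^ v) \<le> X.
         f (p ^ v) / real (p ^ v) * ln (real (p ^ v)) * (real (p ^ v) / X) powr d) \<le> (8 * 2 ^ k + 6 * C) / d"
    if d: "0 < d" "d \<le> 1" and X: "0 < X" and nn: "\<And>n. n > 0 \<Longrightarrow> 0 \<le> f n"
      and fp: "\<And>p v. prime p \<Longrightarrow> f (p ^ v) \<le> (real v + 1) ^ k" for d X :: real and f :: "nat \<Rightarrow> real"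
  proof -
    define P where "P = {p. prime p \<and> real p \<le> X}"
    define Q where "Q = {(p, v). prime p \<and> 0 < v \<and> real (p ^ v) \<le> X}"
    define N where "N = Max (insert 2 (snd ` Q))"
    have finQ: "finite Q" unfolding Q_def by (rule finite_prime_powers_le)
    have P: "prime p" "real p \<ge> 2" "p > 0" "real p \<le> X" if "p \<in> P" for p
      using that prime_ge_2_nat[of p] by (auto simp: P_def)
    have finP: "finite P" by (simp add: P_def)
    define g where "g = (\<lambda>p v. f (p ^ v) / real (p ^ v) * ln (real (p ^ v)) * (real (p ^ v) / X) powr d)"
    have gnn: "0 \<le> g p v" if "p \<in> P" for p v
      using P[OF that] nn[of "p ^ v"] by (auto simp: g_def intro!: mult_nonneg_nonneg one_le_power)
    have QN: "v \<le> N" if "(p, v) \<in> Q" for p v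
      using that finQ unfolding N_def by (intro Max_ge) (auto intro: rev_image_eqI)
    have Q: "p \<in> P" "v > 0" "real (p ^ v) \<le> X" if "(p, v) \<in> Q" for p v
    proof -
      show "v > 0" "real (p ^ v) \<le> X" using that by (auto simp: Q_def)
      have pv: "prime p" using that by (auto simp: Q_def)
      have "p ^ 1 \<le> p ^ v" using pv \<open>v > 0\<close> by (intro power_increasing) (auto simp: Suc_le_eq prime_gt_0_nat)
      thus "p \<in> P" using that pv unfolding P_def Q_def by (auto simp del: of_nat_power)
    qed
    have "Q = Q \<inter> {x. snd x = 1} \<union> Q \<inter> {x. snd x \<noteq> 1}" by blast
    hence "(\<Sum>(p, v)\<in>Q. g p v) = (\<Sum>(p, v)\<in>Q \<inter> {x. snd x = 1}. g p v) + (\<Sum>(p, v)\<in>Q \<inter> {x. snd x \<noteq> 1}. g p v)"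
      using finQ by (subst sum.union_disjoint[symmetric]) auto
    also have "(\<Sum>(p, v)\<in>Q \<inter> {x. snd x = 1}. g p v) \<le> (\<Sum>(p, v)\<in>P \<times> {1}. g p v)"
      using finP gnn Q by (intro sum_mono2) auto
    also have "\<dots> = (\<Sum>p\<in>P. g p 1)" by (subst sum.cartesian_product[symmetric]) simp
    also have "\<dots> \<le> (\<Sum>p\<in>P. 2 ^ k * X powr (- d) * (ln (real p) * real p powr (d - 1)))"
    proof (intro sum_mono)
      fix p assume p: "p \<in> P"
      have "f p \<le> 2 ^ k" using fp[of p 1] P[OF p] by simp
      moreover have "g p 1 = f p * (X powr (- d) * (ln (real p) * real p powr (d - 1)))"
        using P[OF p] X by (simp add: g_def powr_divide powr_diff powr_minus_divide mult_ac)
      ultimately show "g p 1 \<le> 2 ^ k * X powr (- d) * (ln (real p) * real p powr (d - 1))"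
        using P[OF p] by (auto simp: mult.assoc intro!: mult_right_mono mult_nonneg_nonneg)
    qed
    also have "\<dots> = 2 ^ k * X powr (- d) * (\<Sum>p\<in>P. ln (real p) * real p powr (d - 1))"
      by (simp add: sum_distrib_left)
    also have "\<dots> \<le> 2 ^ k * X powr (- d) * (8 / d * X powr d)"
      unfolding P_def using d X by (intro mult_left_mono sum_ln_powr_primes_le) auto
    also have "\<dots> = 8 * 2 ^ k / d" using X by (simp add: powr_minus_divide)
    also have "(\<Sum>(p, v)\<in>Q \<inter> {x. snd x \<noteq> 1}. g p v) \<le> (\<Sum>(p, v)\<in>Q \<inter> {x. snd x \<noteq> 1}. ln (real p) * ((real v + 1) ^ (k + 1) / real p ^ v))"
    proof (intro sum_mono, clarsimp)
      fix p v assume pv: "(p, v) \<in> Q"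
      have p: "p \<in> P" using Q[OF pv] by simp
      have "(real (p ^ v) / X) powr d \<le> 1"
        using Q[OF pv] X d by (intro powr_le1) auto
      hence "g p v \<le> f (p ^ v) / real (p ^ v) * ln (real (p ^ v)) * 1"
        unfolding g_def using P[OF p] nn[of "p ^ v"]
        by (intro mult_left_mono mult_nonneg_nonneg) (auto intro!: one_le_power)
      also have "\<dots> = ln (real p) * (f (p ^ v) * real v / real p ^ v)"
        using P[OF p] by (simp add: ln_realpow)
      also have "\<dots> \<le> ln (real p) * ((real v + 1) ^ k * (real v + 1) / real p ^ v)"
        using P[OF p] fp[of p v] nn[of "p ^ v"] by (intro mult_left_mono divide_right_mono mult_mono) auto
      finally show "g p v \<le> ln (real p) * ((real v + 1) * (real v + 1) ^ k) / real p ^ v"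
        by (simp add: mult.commute)
    qed
    also have "\<dots> \<le> (\<Sum>(p, v)\<in>P \<times> {2..N}. ln (real p) * ((real v + 1) ^ (k + 1) / real p ^ v))"
    proof (intro sum_mono2)
      show "Q \<inter> {x. snd x \<noteq> 1} \<subseteq> P \<times> {2..N}"
      proof clarsimp
        fix p v assume pv: "(p, v) \<in> Q" "v \<noteq> Suc 0"
        show "p \<in> P \<and> 2 \<le> v \<and> v \<le> N" using Q[OF pv(1)] QN[OF pv(1)] pv(2) by auto
      qed
    qed (use finP P in \<open>auto simp: Suc_le_eq intro!: mult_nonneg_nonneg divide_nonneg_nonneg\<close>)
    also have "\<dots> = (\<Sum>p\<in>P. ln (real p) * (\<Sum>v=2..N. (real v + 1) ^ (k + 1) / real p ^ v))"
      by (subst sum.cartesian_product[symmetric]) (simp add: sum_distrib_left)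
    also have "\<dots> \<le> (\<Sum>p\<in>P. 2 * C * real p powr (- 1 - 1 / 2))"
    proof (intro sum_mono)
      fix p assume p: "p \<in> P"
      have "ln (real p) * (\<Sum>v=2..N. (real v + 1) ^ (k + 1) / real p ^ v) \<le> ln (real p) * (C / (real p)\<^sup>2)"
        using P[OF p] by (intro mult_left_mono C) auto
      also have "\<dots> = C * (ln (real p) / (real p)\<^sup>2)" by simp
      also have "\<dots> \<le> C * (2 * real p powr (- 1 - 1 / 2))"
        using C(1) P[OF p] by (intro mult_left_mono ln_div_square_le) auto
      finally show "ln (real p) * (\<Sum>v=2..N. (real v + 1) ^ (k + 1) / real p ^ v) \<le> 2 * C * real p powr (- 1 - 1 / 2)"
        by simp
    qed
    also have "\<dots> = 2 * C * (\<Sum>p\<in>P. real p powr (- 1 - 1 / 2))" by (simp add: sum_distrib_left)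
    also have "\<dots> \<le> 2 * C * 3" unfolding P_def using C(1) by (intro mult_left_mono sum_primes_powr_le) auto
    \<comment> \<open>Since \<open>d \<le> 1\<close>, a bounded contribution fits under
      \<open>1 / d\<close>.\<close>
    also have "2 * C * 3 \<le> 6 * C / d" using C(1) d by (simp add: field_simps)
    finally show ?thesis by (simp add: Q_def g_def add_divide_distrib)
  qed
  thus ?thesis using C by (intro exI[of _ "8 * 2 ^ k + 6 * C"]) (auto intro: add_pos_pos)
qed

lemma ln_eq_sum_prime_factors:
  assumes "b > (0::nat)"
  shows "ln (real b) = (\<Sum>p\<in>prime_factors b. ln (real (p ^ multiplicity p b)))"
proof -
  have "ln (real b) = ln (\<Prod>p\<in>prime_factors b. real (p ^ multiplicity p b))"
    by (subst prime_factorization_nat[OF assms]) (simp only: of_nat_prod)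
  also have "\<dots> = (\<Sum>p\<in>prime_factors b. ln (real (p ^ multiplicity p b)))"
    by (intro ln_prod) (auto dest: in_prime_factors_imp_prime prime_gt_0_nat)
  finally show ?thesis .
qed

text \<open>Expand \<open>ln b\<close> over the prime powers \<open>q\<close> exactly dividing
  \<open>b = q * m\<close> and exchange the sums. For fixed \<open>m\<close> put
  \<open>X = z / m\<close>: then \<open>q \<le> X\<close> and \<open>b / z = q / X\<close>, so the
  sum over \<open>q\<close> is \<open>O(1 / d)\<close> uniformly in \<open>m\<close>.\<close>

lemma sum_sqfull_below_ln_le:
  "\<exists>C>0. \<forall>d y z f. 0 < d \<longrightarrow> d \<le> 1 \<longrightarrow> 0 < z \<longrightarrow> multiplicative f \<longrightarrow> (\<forall>n>0. 0 \<le> f n) \<longrightarrow>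
     (\<forall>p v. prime p \<longrightarrow> f (p ^ v) \<le> (real v + 1) ^ k) \<longrightarrow>
     (\<Sum>b | 0 < b \<and> real b \<le> z \<and> sqfull_below y b. f b / real b * ln (real b) * (real b / z) powr d)
       \<le> C / d * (\<Sum>b | 0 < b \<and> real b \<le> z \<and> sqfull_below y b. f b / real b)"
proof -
  obtain C where C: "C > 0"
    "\<And>d X f. 0 < d \<Longrightarrow> d \<le> 1 \<Longrightarrow> 0 < X \<Longrightarrow> (\<forall>n>0. 0 \<le> f n) \<Longrightarrow>
     (\<forall>p v. prime p \<longrightarrow> f (p ^ v) \<le> (real v + 1) ^ k) \<Longrightarrow>
     (\<Sum>(p, v) | prime p \<and> 0 < v \<and> real (p ^ v) \<le> X.
         f (p ^ v) / real (p ^ v) * ln (real (p ^ v)) * (real (p ^ v) / X) powr d) \<le> C / d"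
    using sum_prime_powers_le[of k] by blast
  have "(\<Sum>b | 0 < b \<and> real b \<le> z \<and> sqfull_below y b. f b / real b * ln (real b) * (real b / z) powr d)
       \<le> C / d * (\<Sum>b | 0 < b \<and> real b \<le> z \<and> sqfull_below y b. f b / real b)"
    if d: "0 < d" "d \<le> 1" and z: "0 < z" and mf: "multiplicative f" and nn: "\<forall>n>0. 0 \<le> f n"
      and fp: "\<forall>p v. prime p \<longrightarrow> f (p ^ v) \<le> (real v + 1) ^ k" for d y z :: real and f :: "nat \<Rightarrow> real"
  proof -
    define B where "B = {b. 0 < b \<and> real b \<le> z \<and> sqfull_below y b}"
    define Q where "Q = (\<lambda>X. {(p, v). prime p \<and> 0 < v \<and> real (p ^ v) \<le> X})"
    define g where "g = (\<lambda>X (p, v). f (p ^ v) / real (p ^ v) * ln (real (p ^ v)) * (real (p ^ v) / X) powr d)"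
    have finB: "finite B" by (simp add: B_def)
    have finQ: "finite (Q X)" for X unfolding Q_def by (rule finite_prime_powers_le)
    have B: "b > 0" if "b \<in> B" for b using that by (simp add: B_def)
    have "(\<Sum>b\<in>B. f b / real b * ln (real b) * (real b / z) powr d)
        = (\<Sum>b\<in>B. \<Sum>p\<in>prime_factors b. f b / real b * ln (real (p ^ multiplicity p b)) * (real b / z) powr d)"
    proof (intro sum.cong refl)
      fix b assume "b \<in> B"
      show "f b / real b * ln (real b) * (real b / z) powr d
          = (\<Sum>p\<in>prime_factors b. f b / real b * ln (real (p ^ multiplicity p b)) * (real b / z) powr d)"
        unfolding ln_eq_sum_prime_factors[OF B[OF \<open>b \<in> B\<close>]] sum_distrib_left sum_distrib_right ..
    qed
    also have "\<dots> = (\<Sum>(b, p)\<in>Sigma B prime_factors. f b / real b * ln (real (p ^ multiplicity p b)) * (real b / z) powr d)"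
      using finB by (subst sum.Sigma) auto
    also have "\<dots> \<le> (\<Sum>(m, q)\<in>Sigma B (\<lambda>m. Q (z / real m)). f m / real m * g (z / real m) q)"
    \<comment> \<open>The pair \<open>(b, p)\<close> is recovered from \<open>(m, p, v)\<close>;
      coprimality of \<open>p\<close> and \<open>m\<close> is dropped on the larger side, where all
      terms are nonnegative.\<close>
    proof (rule sum_le_included[where i = "\<lambda>(m, p, v). (p ^ v * m, p)"])
      show "finite (SIGMA m:B. Q (z / real m))" using finB finQ by auto
      show "\<forall>x\<in>SIGMA m:B. Q (z / real m). 0 \<le> (case x of (m, q) \<Rightarrow> f m / real m * g (z / real m) q)"
        using B nn by (auto simp: g_def Q_def Suc_le_eq prime_gt_0_nat
            intro!: mult_nonneg_nonneg divide_nonneg_nonneg one_le_power)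
      show "\<forall>x\<in>Sigma B prime_factors. \<exists>t\<in>SIGMA m:B. Q (z / real m).
          (case t of (m, p, v) \<Rightarrow> (p ^ v * m, p)) = x \<and>
          (case x of (b, p) \<Rightarrow> f b / real b * ln (real (p ^ multiplicity p b)) * (real b / z) powr d)
          \<le> (case t of (m, q) \<Rightarrow> f m / real m * g (z / real m) q)"
      proof safe
        fix b p assume b: "b \<in> B" and p: "p \<in> prime_factors b"
        define v where "v = multiplicity p b"
        have pp: "prime p" "v > 0" using p by (auto simp: v_def prime_factors_multiplicity)
        obtain m where m: "b = p ^ v * m" "m > 0" "coprime (p ^ v) m"
          "\<And>q. prime q \<Longrightarrow> multiplicity q m = (if q = p then 0 else multiplicity q b)"
          using coprime_cofactor[OF pp(1) B[OF b]] unfolding v_def by blast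
        have pv: "p ^ v > 0" using pp by (simp add: prime_gt_0_nat)
        have bz: "real (p ^ v) * real m \<le> z" using b m(1) by (auto simp: B_def)
        have "m \<le> b" using m(1) B[OF b] by (intro dvd_imp_le) auto
        hence "real m \<le> z" using b by (auto simp: B_def)
        \<comment> \<open>Removing all of \<open>p\<close> from \<open>b\<close> cannot create a
          multiplicity 1, so \<open>m\<close> lies in the same index set.\<close>
        hence "m \<in> B" using m sqfull_below_cofactor[of y b m p] b by (auto simp: B_def)
        moreover have "(p, v) \<in> Q (z / real m)" using pp bz m by (simp add: Q_def field_simps)
        moreover have "f b = f (p ^ v) * f m"
          using mf m pv unfolding multiplicative_def by blast
        hence "f b / real b * ln (real (p ^ v)) * (real b / z) powr d = f m / real m * g (z / real m) (p, v)"
          using m(1) by (simp add: g_def mult_ac)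
        ultimately show "\<exists>t\<in>SIGMA m:B. Q (z / real m).
          (case t of (m, p, v) \<Rightarrow> (p ^ v * m, p)) = (b, p) \<and>
          f b / real b * ln (real (p ^ multiplicity p b)) * (real b / z) powr d
          \<le> (case t of (m, q) \<Rightarrow> f m / real m * g (z / real m) q)"
          using m(1) unfolding v_def[symmetric] by (intro bexI[of _ "(m, p, v)"]) auto
      qed
    qed (use finB in auto)
    also have "\<dots> = (\<Sum>m\<in>B. f m / real m * (\<Sum>q\<in>Q (z / real m). g (z / real m) q))"
      unfolding sum_distrib_left using finB finQ by (subst sum.Sigma) auto
    also have "\<dots> \<le> (\<Sum>m\<in>B. f m / real m * (C / d))"
    proof (intro sum_mono mult_left_mono)
      fix m assume "m \<in> B"
      show "(\<Sum>q\<in>Q (z / real m). g (z / real m) q) \<le> C / d"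
        unfolding Q_def g_def using C(2)[OF d _ nn fp, of "z / real m"] B[OF \<open>m \<in> B\<close>] z by simp
      show "0 \<le> f m / real m" using nn B[OF \<open>m \<in> B\<close>] by simp
    qed
    finally show ?thesis by (simp add: B_def sum_distrib_left mult.commute)
  qed
  thus ?thesis using C(1) by blast
qed

section \<open>Primitive sets\<close>

text \<open>The primes composing the factor \<open>x\<close> of \<open>a\<close>, kept as a set so
  that the antichain inequality applies.\<close>

definition exact_primes :: "real \<Rightarrow> nat \<Rightarrow> nat set" where
  "exact_primes y a = {p \<in> prime_factors a. real p \<le> y \<and> multiplicity p a = 1}"

text \<open>The cofactor \<open>b = a / x\<close>; the division is exact, as distinct primes
  dividing \<open>a\<close> have a product dividing \<open>a\<close>.\<close>

definition sqfull_part :: "real \<Rightarrow> nat \<Rightarrow> nat" where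
  "sqfull_part y a = a div \<Prod>(exact_primes y a)"

lemma finite_exact_primes [simp]: "finite (exact_primes y a)"
  by (simp add: exact_primes_def)

lemma exact_primes_prime: "p \<in> exact_primes y a \<Longrightarrow> prime p"
  by (auto simp: exact_primes_def)

lemma exact_primes_decomposition:
  assumes "a > 0"
  shows "a = \<Prod>(exact_primes y a) * sqfull_part y a" "sqfull_part y a > 0"
    "coprime (\<Prod>(exact_primes y a)) (sqfull_part y a)" "sqfull_below y (sqfull_part y a)"
proof -
  define S where "S = exact_primes y a"
  define b where "b = sqfull_part y a"
  have S: "finite S" "\<And>p. p \<in> S \<Longrightarrow> prime p" by (auto simp: S_def exact_primes_prime)
  have "\<Prod>S dvd a" using S by (intro prod_primes_dvd) (auto simp: S_def exact_primes_def)
  thus ab: "a = \<Prod>S * b" by (simp add: b_def sqfull_part_def S_def)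
  thus b0: "b > 0" using assms by (cases b) auto
  have S0: "\<Prod>S \<noteq> 0" using ab assms by (intro notI) simp
  have mult: "multiplicity p b = (if p \<in> S then 0 else multiplicity p a)" if p: "prime p" for p
  proof -
    have "multiplicity p a = multiplicity p (\<Prod>S) + multiplicity p b"
      using ab S0 b0 p by (metis prime_elem_multiplicity_mult_distrib prime_imp_prime_elem not_gr_zero)
    moreover have "multiplicity p (\<Prod>S) = (if p \<in> S then 1 else 0)"
      using multiplicity_prod_prime_powers[OF S(1,2) p, of "\<lambda>_. 1"] by simp
    moreover have "multiplicity p a = 1" if "p \<in> S" using that by (simp add: S_def exact_primes_def)
    ultimately show ?thesis by auto
  qed
  show "coprime (\<Prod>S) b"
  proof (rule prod_coprime_left)
    fix p assume p: "p \<in> S"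
    hence "multiplicity p b = 0" using mult S by simp
    hence "\<not> p dvd b" using b0 prime_multiplicity_gt_zero_iff[of p b] S(2)[OF p] by simp
    thus "coprime p b" using S(2)[OF p] by (simp add: prime_imp_coprime)
  qed
  show "sqfull_below y b" unfolding sqfull_below_def
  proof (intro allI impI notI)
    fix p assume p: "prime p" "real p \<le> y" "multiplicity p b = 1"
    hence "p \<notin> S" "multiplicity p a = 1" using mult[OF p(1)] by (auto split: if_splits)
    thus False using p by (auto simp: S_def exact_primes_def prime_factors_multiplicity)
  qed
qed

lemma multiplicative_prod_primes:
  fixes f :: "nat \<Rightarrow> real"
  assumes "multiplicative f" "finite S" "\<And>p. p \<in> S \<Longrightarrow> prime p"
  shows "f (\<Prod>S) = (\<Prod>p\<in>S. f p)"
  using assms(2,3)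
proof (induction S rule: finite_induct)
  case (insert q S)
  have "coprime q (\<Prod>S)" using insert by (intro prod_coprime_right primes_coprime) auto
  moreover have "\<Prod>S > 0" "q > 0" using insert by (auto intro!: prod_pos prime_gt_0_nat)
  ultimately have "f (q * \<Prod>S) = f q * f (\<Prod>S)" using assms(1) by (simp add: multiplicative_def)
  thus ?case using insert by simp
qed (use assms in \<open>simp add: multiplicative_def\<close>)

text \<open>Grouping by the cofactor \<open>b\<close> leaves, for each \<open>b\<close>, an
  antichain of prime sets. The weight \<phi> stays arbitrary so that it can later carry both plain
  and logarithmic terms.\<close>

lemma primitive_weighted_sum_le:
  fixes w \<phi> :: "nat \<Rightarrow> real"
  assumes "primitive_set A" "\<And>a. a \<in> A \<Longrightarrow> 0 < a \<and> real a \<le> z"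
  assumes "\<And>p. prime p \<Longrightarrow> 0 \<le> w p" "(\<Sum>p | prime p \<and> real p \<le> y. w p) \<le> W" "W > 0"
  assumes "\<And>b. b > 0 \<Longrightarrow> 0 \<le> \<phi> b"
  shows "(\<Sum>a\<in>A. \<phi> (sqfull_part y a) * (\<Prod>p\<in>exact_primes y a. w p))
    \<le> 2 * exp W / sqrt (W + 1) * (\<Sum>b | 0 < b \<and> real b \<le> z \<and> sqfull_below y b. \<phi> b)"
proof -
  define B where "B = {b. 0 < b \<and> real b \<le> z \<and> sqfull_below y b}"
  define D where "D = 2 * exp W / sqrt (W + 1)"
  have "A \<subseteq> {a. 0 < a \<and> real a \<le> z \<and> True}" using assms(2) by auto
  hence finA: "finite A" by (rule finite_subset) (rule finite_nats_le)
  have finB: "finite B" by (simp add: B_def)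
  have sub: "sqfull_part y ` A \<subseteq> B"
  proof safe
    fix a assume "a \<in> A"
    hence a: "0 < a" "real a \<le> z" using assms(2) by auto
    have "sqfull_part y a \<le> a" by (simp add: sqfull_part_def)
    thus "sqfull_part y a \<in> B" using exact_primes_decomposition[OF a(1)] a by (auto simp: B_def)
  qed
  have "(\<Sum>a\<in>A. \<phi> (sqfull_part y a) * (\<Prod>p\<in>exact_primes y a. w p))
      = (\<Sum>b\<in>B. \<Sum>a | a \<in> A \<and> sqfull_part y a = b. \<phi> (sqfull_part y a) * (\<Prod>p\<in>exact_primes y a. w p))"
    by (rule sum.group[OF finA finB sub, symmetric])
  also have "\<dots> = (\<Sum>b\<in>B. \<phi> b * (\<Sum>a | a \<in> A \<and> sqfull_part y a = b. \<Prod>p\<in>exact_primes y a. w p))"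
    unfolding sum_distrib_left by (intro sum.cong) auto
  also have "\<dots> \<le> (\<Sum>b\<in>B. \<phi> b * D)"
  proof (intro sum_mono mult_left_mono)
    fix b assume b: "b \<in> B"
    show "0 \<le> \<phi> b" using b assms(6) by (simp add: B_def)
    define Ab where "Ab = {a. a \<in> A \<and> sqfull_part y a = b}"
    have Ab: "a = \<Prod>(exact_primes y a) * b" "a \<in> A" if "a \<in> Ab" for a
      using that exact_primes_decomposition(1)[of a y] assms(2) by (auto simp: Ab_def)
    \<comment> \<open>Primitivity enters here: with equal cofactors, inclusion of the prime sets is
      divisibility.\<close>
    have eq: "a = a'" if "a \<in> Ab" "a' \<in> Ab" "exact_primes y a \<subseteq> exact_primes y a'" for a a'
    proof -
      have "\<Prod>(exact_primes y a) * b dvd \<Prod>(exact_primes y a') * b"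
        using that by (intro mult_dvd_mono prod_dvd_prod_subset) auto
      hence "a dvd a'" using Ab(1)[OF that(1)] Ab(1)[OF that(2)] by simp
      thus ?thesis using assms(1) Ab(2)[OF that(1)] Ab(2)[OF that(2)] unfolding primitive_set_def by blast
    qed
    have "inj_on (exact_primes y) Ab" using eq by (auto intro!: inj_onI)
    hence "(\<Sum>a\<in>Ab. \<Prod>p\<in>exact_primes y a. w p) = (\<Sum>S\<in>exact_primes y ` Ab. prod w S)"
      by (simp add: sum.reindex)
    also have "\<dots> \<le> D" unfolding D_def
    proof (rule antichain_weight_le)
      show "exact_primes y ` Ab \<subseteq> Pow {p. prime p \<and> real p \<le> y}"
        by (auto simp: exact_primes_def)
      show "s = t" if "s \<in> exact_primes y ` Ab" "t \<in> exact_primes y ` Ab" "s \<subseteq> t" for s t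
        using that eq by blast
    qed (use assms in auto)
    finally show "(\<Sum>a | a \<in> A \<and> sqfull_part y a = b. \<Prod>p\<in>exact_primes y a. w p) \<le> D" by (simp add: Ab_def)
  qed
  finally show ?thesis by (simp add: B_def D_def sum_distrib_left mult.commute)
qed

text \<open>With \<open>u = d * ln p\<close>, the tilt adds at most \<open>u * exp u\<close> times
  \<open>f p / p\<close>; the factor \<open>d\<close> in \<open>u\<close> cancels the
  \<open>1 / d\<close> of the Chebyshev sum, so the total changes by O(1) when
  \<open>y powr d\<close> is bounded.\<close>

lemma sum_tilted_weights_le:
  fixes f :: "nat \<Rightarrow> real"
  assumes "y \<ge> 1" "0 < d" "d \<le> 1" "\<And>p. prime p \<Longrightarrow> 0 \<le> f p \<and> f p \<le> M"
  shows "(\<Sum>p | prime p \<and> real p \<le> y. f p * real p powr (d - 1))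
    \<le> (\<Sum>p | prime p \<and> real p \<le> y. f p / real p) + 8 * M * y powr d"
proof -
  have M: "M \<ge> 0" using assms(4)[of 2] by simp
  have "(\<Sum>p | prime p \<and> real p \<le> y. f p * real p powr (d - 1))
      \<le> (\<Sum>p | prime p \<and> real p \<le> y. f p / real p + M * d * (ln (real p) * real p powr (d - 1)))"
  proof (intro sum_mono)
    fix p assume "p \<in> {p. prime p \<and> real p \<le> y}"
    hence p: "prime p" "real p \<ge> 1" by (auto simp: Suc_le_eq prime_gt_0_nat)
    define u where "u = d * ln (real p)"
    have u: "u \<ge> 0" using p assms by (simp add: u_def)
    have pd: "real p powr d = exp u" using p by (simp add: powr_def u_def)
    have "1 - u \<le> exp (- u)" using exp_ge_add_one_self[of "- u"] by simp
    hence "(1 - u) * exp u \<le> exp (- u) * exp u" by (intro mult_right_mono) auto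
    hence "exp u - 1 \<le> u * exp u" by (simp add: exp_minus algebra_simps)
    hence "f p / real p * (exp u - 1) \<le> f p / real p * (u * exp u)"
      using assms(4)[OF p(1)] p by (intro mult_left_mono) auto
    also have "\<dots> \<le> M / real p * (u * exp u)"
      using assms(4)[OF p(1)] p u by (intro mult_right_mono divide_right_mono) auto
    finally have "f p / real p * exp u \<le> f p / real p + M / real p * (u * exp u)"
      unfolding right_diff_distrib by simp
    moreover have "real p powr (d - 1) = exp u / real p" using p pd by (simp add: powr_diff)
    ultimately show "f p * real p powr (d - 1) \<le> f p / real p + M * d * (ln (real p) * real p powr (d - 1))"
      by (simp add: u_def mult_ac)
  qed
  also have "\<dots> = (\<Sum>p | prime p \<and> real p \<le> y. f p / real p)
      + M * d * (\<Sum>p | prime p \<and> real p \<le> y. ln (real p) * real p powr (d - 1))"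
    by (simp add: sum.distrib sum_distrib_left)
  also have "M * d * (\<Sum>p | prime p \<and> real p \<le> y. ln (real p) * real p powr (d - 1))
      \<le> M * d * (8 / d * y powr d)"
    using assms M by (intro mult_left_mono sum_ln_powr_primes_le) auto
  also have "M * d * (8 / d * y powr d) = 8 * M * y powr d" using assms by simp
  finally show ?thesis by simp
qed

section \<open>Assembly: multiplying the sum by the logarithm of \<open>z\<close>\<close>

theorem theorem4p1:
  fixes k :: nat
  assumes "k \<ge> 1"
  shows "\<exists>C>0. \<forall>(y::real) (z::real) (A::nat set) (f::nat \<Rightarrow> real).
           2 \<le> y \<longrightarrow> y \<le> z \<longrightarrow> primitive_set A \<longrightarrow> 0 \<notin> A \<longrightarrow> multiplicative f \<longrightarrow>
           (\<forall>n>0. 0 \<le> f n \<and> f n \<le> real (divisor_k k n)) \<longrightarrow>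
           (\<Sum>a\<in>{a\<in>A. z / y \<le> real a \<and> real a \<le> z}. f a / real a)
             \<le> C * (ln y / sqrt ((\<Sum>p\<in>{p::nat. prime p \<and> real p \<le> y}. f p / real p) + 1))
                 * exp (\<Sum>p\<in>{p::nat. prime p \<and> real p \<le> z}. (f p - 1) / real p)"
proof -
  obtain C1 where C1: "C1 > 0"
    "\<And>y z f. 2 \<le> z \<Longrightarrow> multiplicative f \<Longrightarrow> (\<forall>n>0. 0 \<le> f n) \<Longrightarrow>
     (\<forall>p v. prime p \<longrightarrow> f (p ^ v) \<le> (real v + 1) ^ k) \<Longrightarrow>
     (\<Sum>b | 0 < b \<and> real b \<le> z \<and> sqfull_below y b. f b / real b)
       \<le> C1 * exp (\<Sum>p | prime p \<and> real p \<le> z \<and> y < real p. f p / real p)"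
    using sum_sqfull_below_le[of k] by blast
  obtain C2 where C2: "C2 > 0"
    "\<And>d y z f. 0 < d \<Longrightarrow> d \<le> 1 \<Longrightarrow> 0 < z \<Longrightarrow> multiplicative f \<Longrightarrow> (\<forall>n>0. 0 \<le> f n) \<Longrightarrow>
     (\<forall>p v. prime p \<longrightarrow> f (p ^ v) \<le> (real v + 1) ^ k) \<Longrightarrow>
     (\<Sum>b | 0 < b \<and> real b \<le> z \<and> sqfull_below y b. f b / real b * ln (real b) * (real b / z) powr d)
       \<le> C2 / d * (\<Sum>b | 0 < b \<and> real b \<le> z \<and> sqfull_below y b. f b / real b)"
    using sum_sqfull_below_ln_le[of k] by blast
  \<comment> \<open>\<open>K\<close> is \<open>8 * M * y powr d\<close> with
    \<open>M = 2 ^ k\<close> and \<open>y powr d = 2\<close>; \<open>E\<close> is the constant of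
    \<open>sum_inverse_primes_le\<close>; \<open>C3\<close> collects
    \<open>ln y + (1 + 2 * C2) / d\<close> in units of \<open>ln y\<close>.\<close>
  define K where "K = 16 * (2::real) ^ k"
  define E where "E = 17 / ln 2 + (3::real)"
  define C3 where "C3 = 1 + (1 + 2 * C2) / ln 2"
  define C where "C = 2 * exp K * C3 * C1 * exp E"
  have C3: "C3 > 0" using C2(1) by (auto simp: C3_def intro!: add_pos_pos divide_pos_pos)
  have Cpos: "C > 0" using C1(1) C3 by (simp add: C_def)
  have "(\<Sum>a\<in>{a\<in>A. z / y \<le> real a \<and> real a \<le> z}. f a / real a)
       \<le> C * (ln y / sqrt ((\<Sum>p | prime p \<and> real p \<le> y. f p / real p) + 1))
           * exp (\<Sum>p | prime p \<and> real p \<le> z. (f p - 1) / real p)"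
    if y: "2 \<le> y" and yz: "y \<le> z" and prim: "primitive_set A" and A0: "0 \<notin> A" and mf: "multiplicative f"
      and f: "\<forall>n>0. 0 \<le> f n \<and> f n \<le> real (divisor_k k n)"
    for y z :: real and A :: "nat set" and f :: "nat \<Rightarrow> real"
  proof -
    have z: "2 \<le> z" using y yz by simp
    have nn: "\<forall>n>0. 0 \<le> f n" using f by blast
    have fp: "\<forall>p v. prime p \<longrightarrow> f (p ^ v) \<le> (real v + 1) ^ k"
    proof safe
      fix p v :: nat assume p: "prime p"
      hence "f (p ^ v) \<le> real (divisor_k k (p ^ v))" using f by (simp add: prime_gt_0_nat)
      also have "\<dots> \<le> real ((v + 1) ^ k)" using divisor_k_prime_power_le[OF p] by (rule of_nat_mono)
      finally show "f (p ^ v) \<le> (real v + 1) ^ k" by (simp add: add.commute)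
    qed
    have fp1: "0 \<le> f p \<and> f p \<le> 2 ^ k" if "prime p" for p
      using fp[rule_format, OF that, of 1] nn that by (simp add: prime_gt_0_nat)
    \<comment> \<open>The tilt at scale \<open>y\<close>: \<open>y powr d\<close> is the constant 2,
      while \<open>1 / d\<close> is of order \<open>ln y\<close>.\<close>
    define d where "d = ln 2 / ln y"
    have l2: "ln (2::real) > 0" by simp
    have ly: "ln y \<ge> ln 2" "ln y > 0" using y by auto
    have lz: "ln z > 0" using z by simp
    have d: "0 < d" "d \<le> 1" unfolding d_def using ly l2 by (simp_all only: divide_pos_pos divide_le_eq_1_pos)
    have yd: "y powr d = 2" using y ly by (simp add: powr_def d_def)
    have d1: "1 / d = ln y / ln 2" by (simp add: d_def)
    define A' where "A' = {a\<in>A. z / y \<le> real a \<and> real a \<le> z}"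
    define B where "B = {b. 0 < b \<and> real b \<le> z \<and> sqfull_below y b}"
    define L where "L = (\<Sum>p | prime p \<and> real p \<le> y. f p / real p)"
    define R where "R = (\<Sum>p | prime p \<and> real p \<le> z \<and> y < real p. f p / real p)"
    define G where "G = (\<Sum>b\<in>B. f b / real b)"
    define w where "w = (\<lambda>p. f p * real p powr (d - 1))"
    \<comment> \<open>The parts depending on \<open>b\<close> after
      \<open>ln z \<le> ln y + ln x + ln b\<close>, each term carrying \<open>x powr d\<close>:
      \<open>ln y\<close> directly, \<open>1 / d\<close> from \<open>ln x\<close>, and the last
      summand from \<open>ln b\<close> with the Rankin factor.\<close>
    define \<phi> where "\<phi> = (\<lambda>b. f b / real b * (ln y + 1 / d) + 2 * (f b / real b * ln (real b) * (real b / z) powr d))"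
    have L0: "L \<ge> 0" unfolding L_def using fp1 by (intro sum_nonneg) auto
    have K0: "K > 0" by (simp add: K_def)
    have W: "(\<Sum>p | prime p \<and> real p \<le> y. w p) \<le> L + K"
      using sum_tilted_weights_le[of y d f "2 ^ k"] y d fp1 yd by (simp add: w_def L_def K_def)
    have G: "G \<le> C1 * exp R" unfolding G_def B_def R_def using z mf nn fp by (intro C1(2))
    have G0: "G \<ge> 0" unfolding G_def using nn by (intro sum_nonneg) (auto simp: B_def)
    have A': "0 < a \<and> real a \<le> z" "z / y \<le> real a" if "a \<in> A'" for a
      using that A0 by (auto simp: A'_def intro: Nat.gr0I)
    have summand: "f a / real a * ln z \<le> \<phi> (sqfull_part y a) * (\<Prod>p\<in>exact_primes y a. w p)" if a: "a \<in> A'" for a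
    proof -
      define S where "S = exact_primes y a"
      define b where "b = sqfull_part y a"
      define x where "x = \<Prod>S"
      have a0: "a > 0" using A'[OF a] by simp
      note dec = exact_primes_decomposition[OF a0, of y, folded S_def b_def, folded x_def]
      have x0: "x \<ge> 1" using dec(1) a0 by (cases x) auto
      have b0: "b \<ge> 1" using dec(2) by simp
      have S: "finite S" "\<And>p. p \<in> S \<Longrightarrow> prime p" by (auto simp: S_def exact_primes_prime)
      have fa: "f a = f x * f b" using mf dec x0 unfolding multiplicative_def
        by (metis less_le_trans zero_less_one)
      hence fa': "f a / real a = (f x / real x) * (f b / real b)" using dec(1) by simp
      have fx: "f x / real x * real x powr d = (\<Prod>p\<in>S. w p)"
      proof -
        have "(\<Prod>p\<in>S. w p) = (\<Prod>p\<in>S. f p / real p * real p powr d)"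
          using S(2) by (intro prod.cong refl) (auto simp: w_def powr_diff dest: prime_gt_0_nat)
        also have "\<dots> = (\<Prod>p\<in>S. f p) / (\<Prod>p\<in>S. real p) * (\<Prod>p\<in>S. real p powr d)"
          by (simp add: prod.distrib prod_dividef)
        also have "(\<Prod>p\<in>S. f p) = f x" unfolding x_def using mf S by (intro multiplicative_prod_primes[symmetric])
        also have "(\<Prod>p\<in>S. real p powr d) = (\<Prod>p\<in>S. real p) powr d" by (simp add: prod_powr_distrib)
        finally show ?thesis by (simp add: x_def)
      qed
      have fx0: "0 \<le> f x / real x" and fb0: "0 \<le> f b / real b" using nn x0 b0 by auto
      have xd1: "1 \<le> real x powr d" using x0 d by (simp add: ge_one_powr_ge_zero)
      have lnx: "ln (real x) \<le> real x powr d / d"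
      proof -
        have "d * ln (real x) = ln (real x powr d)" using x0 by (simp add: ln_powr)
        also have "\<dots> \<le> real x powr d" using x0 xd1 ln_le_minus_one[of "real x powr d"] by simp
        finally show ?thesis using d by (simp add: field_simps)
      qed
      \<comment> \<open>The lower bound \<open>z / y \<le> a\<close> says
        \<open>1 \<le> y * (b / z) * x\<close>; raising it to the power \<open>d\<close> turns
        \<open>y\<close> into the constant 2.\<close>
      have rankin: "1 \<le> 2 * (real b / z) powr d * real x powr d"
      proof -
        have "z / y \<le> real x * real b" using A'(2)[OF a] dec(1) by (metis of_nat_mult)
        hence "1 \<le> y * (real b / z) * real x" using y z by (simp add: field_simps)
        hence "1 \<le> (y * (real b / z) * real x) powr d" using d by (simp add: ge_one_powr_ge_zero)
        thus ?thesis unfolding powr_mult yd .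
      qed
      have "ln (real a) = ln (real x) + ln (real b)"
        using dec(1) x0 b0 by (simp add: ln_mult_pos)
      moreover have "ln z \<le> ln y + ln (real a)"
      proof -
        have "z \<le> y * real a" using A'(2)[OF a] y by (simp add: field_simps)
        hence "ln z \<le> ln (y * real a)" using z by (intro ln_mono) auto
        thus ?thesis using y a0 by (simp add: ln_mult_pos)
      qed
      \<comment> \<open>The factors 1 are placeholders: the first is replaced by
        \<open>x powr d\<close>, the second by the Rankin bound.\<close>
      ultimately have "ln z \<le> ln y * 1 + ln (real x) + ln (real b) * 1" by simp
      also have "\<dots> \<le> ln y * real x powr d + real x powr d / d + ln (real b) * (2 * (real b / z) powr d * real x powr d)"
        using ly b0 xd1 lnx rankin by (intro add_mono mult_left_mono) auto
      finally have "f a / real a * ln z \<le> (f x / real x) * (f b / real b) *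
         (ln y * real x powr d + real x powr d / d + ln (real b) * (2 * (real b / z) powr d * real x powr d))"
        unfolding fa' using fx0 fb0 by (intro mult_left_mono mult_nonneg_nonneg)
      also have "\<dots> = \<phi> b * (f x / real x * real x powr d)"
        by (simp add: \<phi>_def algebra_simps)
      finally show ?thesis unfolding fx by (simp add: S_def b_def)
    qed
    have "(\<Sum>a\<in>A'. f a / real a) * ln z \<le> (\<Sum>a\<in>A'. \<phi> (sqfull_part y a) * (\<Prod>p\<in>exact_primes y a. w p))"
      unfolding sum_distrib_right by (intro sum_mono summand)
    \<comment> \<open>Antichain bound with \<open>W = L + K\<close>, which is positive even when
      \<open>L = 0\<close>.\<close>
    also have "\<dots> \<le> 2 * exp (L + K) / sqrt (L + K + 1) * (\<Sum>b\<in>B. \<phi> b)"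
      unfolding B_def
    proof (rule primitive_weighted_sum_le[OF _ A'(1) _ W])
      show "primitive_set A'" using prim unfolding primitive_set_def A'_def by blast
      show "0 \<le> w p" if "prime p" for p using fp1[OF that] by (simp add: w_def)
      show "0 \<le> \<phi> b" if "b > 0" for b
        unfolding \<phi>_def using nn that ly d by (intro add_nonneg_nonneg mult_nonneg_nonneg) auto
    qed (use L0 K0 in auto)
    also have "\<dots> \<le> 2 * exp (L + K) / sqrt (L + K + 1) * (C3 * ln y * G)"
    proof (intro mult_left_mono)
      have "(\<Sum>b\<in>B. \<phi> b) = (ln y + 1 / d) * G + 2 * (\<Sum>b\<in>B. f b / real b * ln (real b) * (real b / z) powr d)"
        unfolding \<phi>_def G_def by (simp add: sum.distrib sum_distrib_left mult.commute)
      also have "\<dots> \<le> (ln y + 1 / d) * G + 2 * (C2 / d * G)"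
        unfolding B_def G_def using d z mf nn fp by (intro add_left_mono mult_left_mono C2(2)) auto
      also have "\<dots> = (ln y + (1 + 2 * C2) * (1 / d)) * G" by (simp add: algebra_simps add_divide_distrib)
      also have "\<dots> = C3 * ln y * G" unfolding d1 C3_def by (simp add: algebra_simps)
      finally show "(\<Sum>b\<in>B. \<phi> b) \<le> C3 * ln y * G" .
    qed (use L0 K0 in auto)
    \<comment> \<open>Dropping \<open>K\<close> under the root yields the required
      \<open>sqrt (L + 1)\<close>; the factor \<open>exp K\<close> goes into
      \<open>C\<close>.\<close>
    also have "\<dots> \<le> 2 * exp (L + K) / sqrt (L + 1) * (C3 * ln y * (C1 * exp R))"
      using L0 K0 G0 G C3 ly by (intro mult_mono divide_left_mono) auto
    finally have main: "(\<Sum>a\<in>A'. f a / real a) * ln z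
        \<le> 2 * exp (L + K) / sqrt (L + 1) * (C3 * ln y * (C1 * exp R))" .
    have split: "(\<Sum>p | prime p \<and> real p \<le> z. f p / real p) = L + R"
    proof -
      have "{p. prime p \<and> real p \<le> z} = {p. prime p \<and> real p \<le> y} \<union> {p. prime p \<and> real p \<le> z \<and> y < real p}"
        using yz by auto
      moreover have "finite {p. prime p \<and> real p \<le> z \<and> y < real p}"
        by (rule finite_subset[OF _ finite_primes_le[of z]]) auto
      ultimately show ?thesis unfolding L_def R_def by (simp add: sum.union_disjoint disjoint_iff)
    qed
    \<comment> \<open>\<open>exp L\<close> from the antichains and \<open>exp R\<close> from the
      cofactors form the full sum over \<open>p \<le> z\<close>. Passing from \<open>f p\<close> to
      \<open>f p - 1\<close> costs \<open>exp E * ln z\<close>, and this \<open>ln z\<close> cancels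
      the one multiplied in.\<close>
    have "exp (L + R) \<le> exp E * ln z * exp (\<Sum>p | prime p \<and> real p \<le> z. (f p - 1) / real p)"
    proof -
      have "(\<Sum>p | prime p \<and> real p \<le> z. (f p - 1) / real p)
          = L + R - (\<Sum>p | prime p \<and> real p \<le> z. 1 / real p)"
        unfolding split[symmetric] by (simp add: diff_divide_distrib sum_subtractf)
      hence "L + R \<le> E + ln (ln z) + (\<Sum>p | prime p \<and> real p \<le> z. (f p - 1) / real p)"
        using sum_inverse_primes_le[OF z] by (simp add: E_def)
      hence "exp (L + R) \<le> exp (E + ln (ln z) + (\<Sum>p | prime p \<and> real p \<le> z. (f p - 1) / real p))" by simp
      thus ?thesis using lz by (simp add: exp_add)
    qed
    hence "2 * exp K * C3 * C1 * (ln y / sqrt (L + 1)) * exp (L + R) \<le> 2 * exp K * C3 * C1 * (ln y / sqrt (L + 1)) *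
       (exp E * ln z * exp (\<Sum>p | prime p \<and> real p \<le> z. (f p - 1) / real p))"
      using C3 C1(1) ly L0 by (intro mult_left_mono) auto
    with main have "(\<Sum>a\<in>A'. f a / real a) * ln z
        \<le> (C * (ln y / sqrt (L + 1)) * exp (\<Sum>p | prime p \<and> real p \<le> z. (f p - 1) / real p)) * ln z"
      by (simp add: C_def exp_add mult_ac)
    hence "(\<Sum>a\<in>A'. f a / real a) \<le> C * (ln y / sqrt (L + 1)) * exp (\<Sum>p | prime p \<and> real p \<le> z. (f p - 1) / real p)"
      using lz by (rule mult_right_le_imp_le)
    thus ?thesis by (simp only: A'_def L_def)
  qed
  thus ?thesis using Cpos by (intro exI[of _ C]) blast
qed

end
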